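(* Let $n>2$ be an odd integer, let $D_{2n}$ be the dihedral group of order $2n$, let $\mathbb{F}_q$ be a finite field of order $q=p^k$ with $p$ prime and $p\mid n$, and let $\alpha:D_{2n}\times D_{2n}\to\mathbb{F}_q^*$ be a normalized $2$-cocycle. Then, as $\mathbb{F}_q$-vector spaces, $$HH^1(\mathbb{F}_q^\alpha D_{2n})\cong \mathbb{F}_q^{\frac{n-1}{2}}.$$
   Context: $D_{2n}=\langle r,s\mid r^n=s^2=(rs)^2=1\rangle$ is the dihedral group with $2n$ elements. For a group $G$ and a field $F$, a $2$-cocycle is a map $\alpha:G\times G\to F^*$ with $\alpha(x,y)\alpha(xy,z)=\alpha(y,z)\alpha(x,yz)$ for all $x,y,z\in G$; it is normalized if $\alpha(1,g)=\alpha(g,1)=1$ for all $g\in G$. The twisted group ring $F^\alpha G$ is the $F$-vector space with basis $\{\overline{g}:g\in G\}$ and product $(a\overline{g})(b\overline{h})=ab\,\alpha(g,h)\,\overline{gh}$, extended by linearity. For an $F$-algebra $A$, $HH^1(A)=HH^1(A,A)=\mathrm{Der}(A)/\mathrm{Inn}(A)$, where $\mathrm{Der}(A)$ is the space of $F$-linear maps $d:A\to A$ with $d(ab)=d(a)b+a\,d(b)$ for all $a,b\in A$, and $\mathrm{Inn}(A)$ is the subspace of maps $x\mapsto ax-xa$ with $a\in A$. *)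

theory Defs
  imports "Jordan_Normal_Form.VS_Connect" "HOL-Algebra.Generated_Groups" "HOL-Algebra.AbelCoset" "HOL-Library.Poly_Mapping"
begin

text \<open>
  A group \<open>G\<close> generated by elements \<open>r\<close>, \<open>s\<close> with the three relations is a quotient of the presented
  group \<open>\<langle>r, s | r^n = s^2 = (rs)^2 = 1\<rangle>\<close>. The latter has \<open>2 n\<close> elements, so the condition on the
  order says that \<open>G\<close> is isomorphic to it.
\<close>

definition dihedral_group :: "nat \<Rightarrow> ('g, 'm) monoid_scheme \<Rightarrow> bool" where
  "dihedral_group n G \<longleftrightarrow> group G \<and> Coset.order G = 2 * n \<and>
     (\<exists>r \<in> carrier G. \<exists>s \<in> carrier G.
        generate G {r, s} = carrier G \<and>
        r [^]\<^bsub>G\<^esub> n = \<one>\<^bsub>G\<^esub> \<and> s [^]\<^bsub>G\<^esub> (2::nat) = \<one>\<^bsub>G\<^esub> \<and> (r \<otimes>\<^bsub>G\<^esub> s) [^]\<^bsub>G\<^esub> (2::nat) = \<one>\<^bsub>G\<^esub>)"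

definition dihedral_model :: "nat \<Rightarrow> (int \<times> bool) monoid" where
  "dihedral_model n =
     \<lparr>carrier = {0..<int n} \<times> UNIV,
      mult = (\<lambda>(i, b) (j, c). ((i + (if b then - j else j)) mod int n, b \<noteq> c)),
      one = (0, False)\<rparr>"

lemma dihedral_group_dihedral_model:
  assumes "n > 0"
  shows "dihedral_group n (dihedral_model n)"
proof -
  let ?G = "dihedral_model n"
  define r s where "r = (1 mod int n, False)" and "s = (0 :: int, True)"
  have [simp]: "carrier ?G = {0..<int n} \<times> UNIV" "\<one>\<^bsub>?G\<^esub> = (0, False)"
    and mult: "(i, b) \<otimes>\<^bsub>?G\<^esub> (j, c) = ((i + (if b then - j else j)) mod int n, b \<noteq> c)" for i b j c
    by (simp_all add: dihedral_model_def)
  interpret group ?G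
  proof (rule groupI)
    fix x y z assume "x \<in> carrier ?G" "y \<in> carrier ?G" "z \<in> carrier ?G"
    then show "x \<otimes>\<^bsub>?G\<^esub> y \<otimes>\<^bsub>?G\<^esub> z = x \<otimes>\<^bsub>?G\<^esub> (y \<otimes>\<^bsub>?G\<^esub> z)"
      by (cases x; cases y; cases z)
        (auto simp: mult mod_simps algebra_simps)
  next
    fix x assume x: "x \<in> carrier ?G"
    obtain i b where ib: "x = (i, b)" by (cases x)
    have "((if b then i else (- i) mod int n), b) \<in> carrier ?G"
      using x assms by (auto simp: ib)
    moreover have "((if b then i else (- i) mod int n), b) \<otimes>\<^bsub>?G\<^esub> x = \<one>\<^bsub>?G\<^esub>"
      by (auto simp: ib mult mod_simps)
    ultimately show "\<exists>y \<in> carrier ?G. y \<otimes>\<^bsub>?G\<^esub> x = \<one>\<^bsub>?G\<^esub>" by blast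
  qed (use assms in \<open>auto simp: mult\<close>)
  have r: "r \<in> carrier ?G" and s: "s \<in> carrier ?G"
    using assms by (auto simp: r_def s_def)
  have pow: "r [^]\<^bsub>?G\<^esub> m = (int m mod int n, False)" for m :: nat
    by (induction m) (auto simp: r_def mult mod_simps algebra_simps)
  have pow_in: "r [^]\<^bsub>?G\<^esub> m \<in> generate ?G {r, s}" for m :: nat
  proof (induction m)
    case 0
    show ?case using generate.one[of ?G "{r, s}"] by simp
  next
    case (Suc m)
    then show ?case by (simp add: generate.eng generate.incl)
  qed
  have "x \<in> generate ?G {r, s}" if "x \<in> carrier ?G" for x
  proof -
    obtain i b where ib: "x = (i, b)" by (cases x)
    then have i: "r [^]\<^bsub>?G\<^esub> nat i = (i, False)"
      using that by (simp add: pow)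
    show ?thesis
    proof (cases b)
      case True
      then have "x = r [^]\<^bsub>?G\<^esub> nat i \<otimes>\<^bsub>?G\<^esub> s"
        using that by (simp add: ib i s_def mult)
      then show ?thesis
        using pow_in by (simp add: generate.eng generate.incl)
    next
      case False
      then show ?thesis
        using pow_in[of "nat i"] by (simp add: ib i)
    qed
  qed
  moreover have "generate ?G {r, s} \<subseteq> carrier ?G"
    by (rule generate_incl) (use r s in blast)
  ultimately have "generate ?G {r, s} = carrier ?G"
    by blast
  moreover have "Coset.order ?G = 2 * n"
    by (simp add: Coset.order_def card_cartesian_product)
  moreover have "r [^]\<^bsub>?G\<^esub> n = \<one>\<^bsub>?G\<^esub>"
    by (simp add: pow)
  moreover have "s [^]\<^bsub>?G\<^esub> (2::nat) = \<one>\<^bsub>?G\<^esub>" "(r \<otimes>\<^bsub>?G\<^esub> s) [^]\<^bsub>?G\<^esub> (2::nat) = \<one>\<^bsub>?G\<^esub>"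
    using assms by (simp_all add: numeral_2_eq_2 r_def s_def mult)
  ultimately show ?thesis
    unfolding dihedral_group_def using is_group r s
    by (intro conjI bexI[of _ r] bexI[of _ s])
qed

definition two_cocycle :: "('g, 'm) monoid_scheme \<Rightarrow> ('g \<Rightarrow> 'g \<Rightarrow> 'f::field) \<Rightarrow> bool" where
  "two_cocycle G \<alpha> \<longleftrightarrow>
     (\<forall>x \<in> carrier G. \<forall>y \<in> carrier G. \<alpha> x y \<noteq> 0) \<and>
     (\<forall>x \<in> carrier G. \<forall>y \<in> carrier G. \<forall>z \<in> carrier G.
        \<alpha> x y * \<alpha> (x \<otimes>\<^bsub>G\<^esub> y) z = \<alpha> y z * \<alpha> x (y \<otimes>\<^bsub>G\<^esub> z))"

definition normalized_cocycle :: "('g, 'm) monoid_scheme \<Rightarrow> ('g \<Rightarrow> 'g \<Rightarrow> 'f::field) \<Rightarrow> bool" where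
  "normalized_cocycle G \<alpha> \<longleftrightarrow> two_cocycle G \<alpha> \<and>
     (\<forall>g \<in> carrier G. \<alpha> \<one>\<^bsub>G\<^esub> g = 1 \<and> \<alpha> g \<one>\<^bsub>G\<^esub> = 1)"

text \<open>
  The basis element indexed by \<open>g\<close> is \<open>Poly_Mapping.single g 1\<close>. The unit below is the correct one for
  normalized cocycles only (in general it is the multiple of the basis element by the inverse of
  \<open>\<alpha> \<one> \<one>\<close>).
\<close>

definition twisted_group_ring ::
  "('g, 'm) monoid_scheme \<Rightarrow> ('g \<Rightarrow> 'g \<Rightarrow> 'f::field) \<Rightarrow> ('f, 'g \<Rightarrow>\<^sub>0 'f) module" where
  "twisted_group_ring G \<alpha> =
     \<lparr>carrier = {u. Poly_Mapping.keys u \<subseteq> carrier G},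
      mult = (\<lambda>u v. \<Sum>g \<in> Poly_Mapping.keys u. \<Sum>h \<in> Poly_Mapping.keys v.
                Poly_Mapping.single (g \<otimes>\<^bsub>G\<^esub> h)
                  (Poly_Mapping.lookup u g * Poly_Mapping.lookup v h * \<alpha> g h)),
      one = Poly_Mapping.single \<one>\<^bsub>G\<^esub> 1,
      zero = 0,
      add = (+),
      smult = (\<lambda>c. Poly_Mapping.map ((*) c))\<rparr>"

text \<open>
  Maps \<open>A \<rightarrow> A\<close> are represented by functions that are \<open>undefined\<close> outside the carrier, so that
  equality of maps is equality of functions.
\<close>

definition derivations ::
  "('f, 'k) ring_scheme \<Rightarrow> ('f, 'a, 'm) module_scheme \<Rightarrow> ('a \<Rightarrow> 'a) set" where
  "derivations K A = {d \<in> LinearCombinations.module_hom K A A \<inter> extensional (carrier A).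
     \<forall>a \<in> carrier A. \<forall>b \<in> carrier A.
       d (a \<otimes>\<^bsub>A\<^esub> b) = d a \<otimes>\<^bsub>A\<^esub> b \<oplus>\<^bsub>A\<^esub> a \<otimes>\<^bsub>A\<^esub> d b}"

definition inner_derivations :: "('f, 'a, 'm) module_scheme \<Rightarrow> ('a \<Rightarrow> 'a) set" where
  "inner_derivations A =
     {restrict (\<lambda>x. a \<otimes>\<^bsub>A\<^esub> x \<ominus>\<^bsub>A\<^esub> x \<otimes>\<^bsub>A\<^esub> a) (carrier A) | a. a \<in> carrier A}"

text \<open>
  Both records below only carry a module structure; as in \<^const>\<open>module_vec\<close>, the multiplicative
  fields have no meaning.
\<close>

definition derivation_module ::
  "('f, 'k) ring_scheme \<Rightarrow> ('f, 'a, 'm) module_scheme \<Rightarrow> ('f, 'a \<Rightarrow> 'a) module" where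
  "derivation_module K A =
     \<lparr>carrier = derivations K A, mult = undefined, one = undefined,
      zero = restrict (\<lambda>x. \<zero>\<^bsub>A\<^esub>) (carrier A),
      add = (\<lambda>d e. restrict (\<lambda>x. d x \<oplus>\<^bsub>A\<^esub> e x) (carrier A)),
      smult = (\<lambda>c d. restrict (\<lambda>x. c \<odot>\<^bsub>A\<^esub> d x) (carrier A))\<rparr>"

definition quotient_module ::
  "('f, 'b, 'm) module_scheme \<Rightarrow> 'b set \<Rightarrow> ('f, 'b set) module" where
  "quotient_module M N =
     \<lparr>carrier = a_rcosets\<^bsub>M\<^esub> N, mult = undefined, one = undefined,
      zero = N,
      add = set_add M,
      smult = (\<lambda>c X. \<Union>x\<in>X. N +>\<^bsub>M\<^esub> (c \<odot>\<^bsub>M\<^esub> x))\<rparr>"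

definition HH1 ::
  "('f, 'k) ring_scheme \<Rightarrow> ('f, 'a, 'm) module_scheme \<Rightarrow> ('f, ('a \<Rightarrow> 'a) set) module" where
  "HH1 K A = quotient_module (derivation_module K A) (inner_derivations A)"

definition isomorphic_vector_spaces ::
  "('f, 'k) ring_scheme \<Rightarrow> ('f, 'a, 'm) module_scheme \<Rightarrow> ('f, 'b, 'l) module_scheme \<Rightarrow> bool" where
  "isomorphic_vector_spaces K V W \<longleftrightarrow>
     (\<exists>T. linear_map K V W T \<and> bij_betw T (carrier V) (carrier W))"

end

theory Submission
  imports Defs
begin

text \<open>
  Write \<open>u\<close>, \<open>v\<close> for the basis elements of the twisted group ring at the generating rotation and
  reflection. As \<open>n\<close> is odd, \<open>u\<close> can be multiplied by a scalar such that \<open>u^n = 1\<close> and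
  \<open>v u = u^(-1) v\<close>, while \<open>v^2\<close> is a nonzero scalar \<open>\<mu>\<close> (\<open>rescale_rotation\<close>,
  \<open>cocycle_normal_form\<close>). So the twisted group ring has a basis \<open>u^i\<close>, \<open>u^i v\<close> with the
  multiplication of the group ring of the dihedral group up to the factor \<open>\<mu>\<close>.

  Let \<open>D\<close> be a derivation and \<open>n = 2 m + 1\<close>. The characteristic \<open>p\<close> is odd, so 2 is invertible, and
  averaging over \<open>v\<close> shows that \<open>D\<close> differs by an inner derivation from one with \<open>D v = 0\<close>
  (\<open>exists_ad_on_reflection\<close>). Then \<open>D\<close> is determined by \<open>D u = u x + y v\<close>, with \<open>x\<close> and
  \<open>y\<close> in the span of the powers of \<open>u\<close>, and the relation between \<open>u\<close> and \<open>v\<close> forces both to be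
  antisymmetric under \<open>u \<mapsto> u^(-1)\<close> (\<open>derivation_killing_reflection\<close>). The part \<open>y v\<close> always
  comes from an inner derivation, by solving a difference equation on the integers modulo \<open>n\<close>
  (\<open>symmetric_primitive_mod_odd\<close>), whereas inner derivations contribute nothing to \<open>x\<close>. Conversely,
  every antisymmetric \<open>x\<close> occurs: \<open>u \<mapsto> u x\<close>, \<open>v \<mapsto> 0\<close> respects the relation \<open>u^n = 1\<close>
  because \<open>D (u^n) = n u^n x\<close> and \<open>p\<close> divides \<open>n\<close> (\<open>antisymmetric_derivation\<close>). Hence the \<open>m\<close>
  free coefficients of \<open>x\<close> define a linear surjection from the derivations onto \<open>m\<close>-tuples with
  kernel the inner derivations, and the quotient is identified by the isomorphism theorem
  (\<open>quotient_by_kernel_isomorphic\<close>).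
\<close>

section \<open>Quotients of modules by kernels\<close>

text \<open>
  The cosets of the kernel are the fibres of \<open>T\<close>, so \<open>w \<mapsto> T\<^sup>-\<^sup>1 w\<close> is a bijection from \<open>W\<close> onto the
  quotient that respects all operations; the module laws are carried over from \<open>W\<close> along it.
\<close>

lemma quotient_by_kernel_isomorphic:
  fixes K :: "('f, 'k) ring_scheme" and M :: "('f, 'b, 'm) module_scheme"
    and W :: "('f, 'c, 'l) module_scheme"
  assumes K: "field K" and M: "Module.module K M" and W: "Module.module K W"
    and T: "T \<in> LinearCombinations.module_hom K M W"
    and surj: "T ` carrier M = carrier W"
    and ker: "N = {x \<in> carrier M. T x = \<zero>\<^bsub>W\<^esub>}"
  shows "isomorphic_vector_spaces K (quotient_module M N) W"
proof -
  interpret M: Module.module K M by fact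
  interpret W: Module.module K W by fact
  interpret T: mod_hom K M W T by unfold_locales fact
  define fib where "fib w = {x \<in> carrier M. T x = w}" for w
  let ?Q = "quotient_module M N"
  have coset: "N +>\<^bsub>M\<^esub> x = fib (T x)" if x: "x \<in> carrier M" for x
  proof
    show "N +>\<^bsub>M\<^esub> x \<subseteq> fib (T x)"
      using x by (auto simp: a_r_coset_def' ker fib_def)
    show "fib (T x) \<subseteq> N +>\<^bsub>M\<^esub> x"
    proof
      fix y assume "y \<in> fib (T x)"
      then have y: "y \<in> carrier M" "T y = T x" by (auto simp: fib_def)
      then have "T (y \<ominus>\<^bsub>M\<^esub> x) = T y \<ominus>\<^bsub>W\<^esub> T x"
        using x by (intro T.f_minus) auto
      then have "y \<ominus>\<^bsub>M\<^esub> x \<in> N"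
        using x y by (simp add: ker W.r_neg W.minus_eq)
      moreover have "y = (y \<ominus>\<^bsub>M\<^esub> x) \<oplus>\<^bsub>M\<^esub> x"
        using x y by (simp add: M.minus_eq M.a_assoc M.l_neg)
      ultimately show "y \<in> N +>\<^bsub>M\<^esub> x"
        by (auto simp: a_r_coset_def')
    qed
  qed
  have lift: "\<exists>x \<in> carrier M. T x = w" if "w \<in> carrier W" for w
    using surj that by (metis imageE)
  have carrier: "carrier ?Q = fib ` carrier W"
  proof -
    have "carrier ?Q = (\<lambda>x. fib (T x)) ` carrier M"
      by (auto simp: quotient_module_def A_RCOSETS_def' coset)
    then show ?thesis by (simp add: surj[symmetric] image_image)
  qed
  have inj: "inj_on fib (carrier W)"
  proof (rule inj_onI)
    fix w w' assume "w \<in> carrier W" "w' \<in> carrier W" "fib w = fib w'"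
    then show "w = w'" using lift[of w] by (auto simp: fib_def)
  qed
  have zero: "\<zero>\<^bsub>?Q\<^esub> = fib \<zero>\<^bsub>W\<^esub>"
    by (simp add: quotient_module_def ker fib_def)
  have add: "fib v \<oplus>\<^bsub>?Q\<^esub> fib w = fib (v \<oplus>\<^bsub>W\<^esub> w)" if vw: "v \<in> carrier W" "w \<in> carrier W" for v w
  proof -
    obtain x where x: "x \<in> carrier M" "T x = v" using lift vw by blast
    have "y \<in> set_add M (fib v) (fib w)" if y: "y \<in> fib (v \<oplus>\<^bsub>W\<^esub> w)" for y
    proof -
      have yM: "y \<in> carrier M" "T y = v \<oplus>\<^bsub>W\<^esub> w" using y by (auto simp: fib_def)
      have "T (y \<ominus>\<^bsub>M\<^esub> x) = T y \<ominus>\<^bsub>W\<^esub> T x"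
        using x yM by (intro T.f_minus) auto
      also have "\<dots> = w"
        unfolding yM(2) x(2) using vw by (simp add: W.minus_eq W.a_comm W.r_neg1)
      finally have "y \<ominus>\<^bsub>M\<^esub> x \<in> fib w" using x yM by (simp add: fib_def)
      moreover have "y = x \<oplus>\<^bsub>M\<^esub> (y \<ominus>\<^bsub>M\<^esub> x)"
        using x yM by (simp add: M.minus_eq M.a_lcomm[of x y] M.r_neg)
      ultimately show ?thesis using x by (auto simp: set_add_def' fib_def)
    qed
    then show ?thesis
      by (auto simp: quotient_module_def set_add_def' fib_def)
  qed
  have smult: "c \<odot>\<^bsub>?Q\<^esub> fib w = fib (c \<odot>\<^bsub>W\<^esub> w)" if c: "c \<in> carrier K" and w: "w \<in> carrier W" for c w
  proof -
    have "N +>\<^bsub>M\<^esub> (c \<odot>\<^bsub>M\<^esub> x) = fib (c \<odot>\<^bsub>W\<^esub> w)" if "x \<in> fib w" for x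
      using that c by (simp add: coset fib_def)
    moreover have "fib w \<noteq> {}" using lift[OF w] by (auto simp: fib_def)
    ultimately show ?thesis by (simp add: quotient_module_def)
  qed
  have module: "Module.module K ?Q"
  proof (rule moduleI)
    show "abelian_group ?Q"
    proof (rule abelian_groupI)
      fix x assume "x \<in> carrier ?Q"
      then obtain w where w: "w \<in> carrier W" "x = fib w" by (auto simp: carrier)
      then have "fib (\<ominus>\<^bsub>W\<^esub> w) \<oplus>\<^bsub>?Q\<^esub> x = \<zero>\<^bsub>?Q\<^esub>" by (simp add: add zero W.l_neg)
      with w show "\<exists>y \<in> carrier ?Q. y \<oplus>\<^bsub>?Q\<^esub> x = \<zero>\<^bsub>?Q\<^esub>" by (auto simp: carrier)
    qed (auto simp: carrier zero add W.a_ac)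
  qed (auto simp: carrier add smult W.smult_l_distr W.smult_r_distr W.smult_assoc1 M.R.is_cring)
  define S where "S = the_inv_into (carrier W) fib"
  have S: "S (fib w) = w" if "w \<in> carrier W" for w
    using the_inv_into_f_f[OF inj that] by (simp add: S_def)
  have "linear_map K ?Q W S"
  proof (intro linear_map.intro vectorspace.intro mod_hom.intro mod_hom_axioms.intro module K W)
    show "S \<in> LinearCombinations.module_hom K ?Q W"
      by (auto simp: LinearCombinations.module_hom_def carrier S add smult)
  qed
  moreover have "bij_betw S (carrier ?Q) (carrier W)"
    by (simp add: S_def carrier bij_betw_the_inv_into inj inj_on_imp_bij_betw)
  ultimately show ?thesis by (auto simp: isomorphic_vector_spaces_def)
qed

section \<open>Derivations of an associative algebra\<close>

text \<open>
  Unlike in \<^locale>\<open>algebra\<close>, the multiplication of \<open>A\<close> may be noncommutative, and scalars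
  have to be moved out of both factors.
\<close>

locale assoc_algebra = Module.module K A + ring A
  for K :: "('f, 'k) ring_scheme" and A :: "('f, 'a, 'm) module_scheme" (structure) +
  assumes smult_mult_left: "c \<in> carrier K \<Longrightarrow> x \<in> carrier A \<Longrightarrow> y \<in> carrier A \<Longrightarrow>
      (c \<odot> x) \<otimes> y = c \<odot> (x \<otimes> y)"
    and smult_mult_right: "c \<in> carrier K \<Longrightarrow> x \<in> carrier A \<Longrightarrow> y \<in> carrier A \<Longrightarrow>
      x \<otimes> (c \<odot> y) = c \<odot> (x \<otimes> y)"
begin

lemma derivationsI:
  assumes "\<And>x. x \<in> carrier A \<Longrightarrow> d x \<in> carrier A"
    and "\<And>x y. x \<in> carrier A \<Longrightarrow> y \<in> carrier A \<Longrightarrow> d (x \<oplus> y) = d x \<oplus> d y"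
    and "\<And>c x. c \<in> carrier K \<Longrightarrow> x \<in> carrier A \<Longrightarrow> d (c \<odot> x) = c \<odot> d x"
    and "\<And>x y. x \<in> carrier A \<Longrightarrow> y \<in> carrier A \<Longrightarrow> d (x \<otimes> y) = d x \<otimes> y \<oplus> x \<otimes> d y"
  shows "restrict d (carrier A) \<in> derivations K A"
  using assms by (auto simp: derivations_def LinearCombinations.module_hom_def)

lemma derivationsD:
  assumes "d \<in> derivations K A"
  shows derivation_closed: "x \<in> carrier A \<Longrightarrow> d x \<in> carrier A"
    and derivation_add: "x \<in> carrier A \<Longrightarrow> y \<in> carrier A \<Longrightarrow> d (x \<oplus> y) = d x \<oplus> d y"
    and derivation_smult: "c \<in> carrier K \<Longrightarrow> x \<in> carrier A \<Longrightarrow> d (c \<odot> x) = c \<odot> d x"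
    and derivation_mult: "x \<in> carrier A \<Longrightarrow> y \<in> carrier A \<Longrightarrow> d (x \<otimes> y) = d x \<otimes> y \<oplus> x \<otimes> d y"
  using assms by (auto simp: derivations_def LinearCombinations.module_hom_def)

lemma derivation_eqI:
  assumes "d \<in> derivations K A" "d' \<in> derivations K A" "\<And>x. x \<in> carrier A \<Longrightarrow> d x = d' x"
  shows "d = d'"
  using assms by (auto intro!: extensionalityI[of _ "carrier A"] simp: derivations_def)

abbreviation "DM \<equiv> derivation_module K A"

lemma DM_simps: "carrier DM = derivations K A"
  "d \<oplus>\<^bsub>DM\<^esub> d' = restrict (\<lambda>x. d x \<oplus> d' x) (carrier A)"
  "c \<odot>\<^bsub>DM\<^esub> d = restrict (\<lambda>x. c \<odot> d x) (carrier A)"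
  "\<zero>\<^bsub>DM\<^esub> = restrict (\<lambda>x. \<zero>) (carrier A)"
  by (simp_all add: derivation_module_def)

lemma DM_zero_closed: "\<zero>\<^bsub>DM\<^esub> \<in> derivations K A"
  unfolding DM_simps by (rule derivationsI) auto

lemma DM_add_closed:
  assumes "d \<in> derivations K A" "d' \<in> derivations K A"
  shows "d \<oplus>\<^bsub>DM\<^esub> d' \<in> derivations K A"
  unfolding DM_simps using assms[THEN derivationsD(1)]
  by (intro derivationsI)
     (simp_all add: assms[THEN derivationsD(2)] assms[THEN derivationsD(3)] assms[THEN derivationsD(4)]
        smult_r_distr l_distr r_distr M.a_ac)

lemma DM_smult_closed:
  assumes "c \<in> carrier K" "d \<in> derivations K A"
  shows "c \<odot>\<^bsub>DM\<^esub> d \<in> derivations K A"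
  unfolding DM_simps using assms(1) derivationsD(1)[OF assms(2)]
  by (intro derivationsI)
     (simp_all add: derivationsD[OF assms(2)] smult_r_distr smult_mult_left smult_mult_right
        smult_assoc1[symmetric] R.m_comm)

lemma derivation_module_module: "Module.module K DM"
proof (rule moduleI)
  show "abelian_group DM"
  proof (rule abelian_groupI)
    fix d assume "d \<in> carrier DM"
    then have d: "d \<in> derivations K A" by (simp add: DM_simps)
    let ?e = "(\<ominus>\<^bsub>K\<^esub> \<one>\<^bsub>K\<^esub>) \<odot>\<^bsub>DM\<^esub> d"
    have e: "?e \<in> derivations K A" using d by (intro DM_smult_closed) auto
    have "?e \<oplus>\<^bsub>DM\<^esub> d = \<zero>\<^bsub>DM\<^esub>"
      using derivation_closed[OF d]
      by (intro derivation_eqI DM_add_closed e d DM_zero_closed)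
         (simp add: DM_simps smult_l_minus M.l_neg)
    with e show "\<exists>e \<in> carrier DM. e \<oplus>\<^bsub>DM\<^esub> d = \<zero>\<^bsub>DM\<^esub>" by (auto simp: DM_simps(1))
  qed (auto intro!: DM_add_closed DM_zero_closed derivation_eqI simp: DM_simps(1),
       auto simp: DM_simps derivation_closed M.a_ac)
qed (auto intro!: DM_add_closed DM_smult_closed derivation_eqI simp: DM_simps(1) R.is_cring,
     auto simp: DM_simps derivation_closed smult_l_distr smult_r_distr smult_assoc1)

definition ad :: "'a \<Rightarrow> 'a \<Rightarrow> 'a" where
  "ad a = restrict (\<lambda>x. a \<otimes> x \<ominus> x \<otimes> a) (carrier A)"

lemma ad_derivation:
  assumes a: "a \<in> carrier A"
  shows "ad a \<in> derivations K A"
  unfolding ad_def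
proof (rule derivationsI)
  fix x y assume x: "x \<in> carrier A" and y: "y \<in> carrier A"
  show "a \<otimes> (x \<oplus> y) \<ominus> (x \<oplus> y) \<otimes> a = a \<otimes> x \<ominus> x \<otimes> a \<oplus> (a \<otimes> y \<ominus> y \<otimes> a)"
    using a x y by algebra
  show "a \<otimes> (x \<otimes> y) \<ominus> x \<otimes> y \<otimes> a = (a \<otimes> x \<ominus> x \<otimes> a) \<otimes> y \<oplus> x \<otimes> (a \<otimes> y \<ominus> y \<otimes> a)"
    using a x y by algebra
next
  fix c x assume c: "c \<in> carrier K" and x: "x \<in> carrier A"
  show "a \<otimes> (c \<odot> x) \<ominus> c \<odot> x \<otimes> a = c \<odot> (a \<otimes> x \<ominus> x \<otimes> a)"
    using a c x by (simp add: smult_mult_left smult_mult_right minus_eq smult_r_distr smult_r_minus)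
qed (use a in simp)

lemma inner_derivations_eq: "inner_derivations A = ad ` carrier A"
  by (auto simp: inner_derivations_def ad_def)

end

section \<open>Twisted group rings\<close>

lemma twisted_group_ring_simps:
  "carrier (twisted_group_ring G \<alpha>) = {u. Poly_Mapping.keys u \<subseteq> carrier G}"
  "u \<oplus>\<^bsub>twisted_group_ring G \<alpha>\<^esub> v = u + v"
  "\<zero>\<^bsub>twisted_group_ring G \<alpha>\<^esub> = 0"
  "\<one>\<^bsub>twisted_group_ring G \<alpha>\<^esub> = Poly_Mapping.single \<one>\<^bsub>G\<^esub> 1"
  by (simp_all add: twisted_group_ring_def)

lemma lookup_twisted_smult:
  "Poly_Mapping.lookup (c \<odot>\<^bsub>twisted_group_ring G \<alpha>\<^esub> u) g = c * Poly_Mapping.lookup u g"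
  by (simp add: twisted_group_ring_def Poly_Mapping.map.rep_eq when_def)

text \<open>
  Summing over any finite sets that contain the supports makes the product visibly bilinear, although
  the supports of sums are smaller than the union of the supports in general.
\<close>

lemma twisted_mult_superset:
  assumes "finite S" "Poly_Mapping.keys u \<subseteq> S" "finite S'" "Poly_Mapping.keys v \<subseteq> S'"
  shows "u \<otimes>\<^bsub>twisted_group_ring G \<alpha>\<^esub> v = (\<Sum>g\<in>S. \<Sum>h\<in>S'. Poly_Mapping.single (g \<otimes>\<^bsub>G\<^esub> h)
           (Poly_Mapping.lookup u g * Poly_Mapping.lookup v h * \<alpha> g h))"
proof -
  have "(\<Sum>h\<in>S'. Poly_Mapping.single (g \<otimes>\<^bsub>G\<^esub> h)
           (Poly_Mapping.lookup u g * Poly_Mapping.lookup v h * \<alpha> g h)) =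
        (\<Sum>h\<in>Poly_Mapping.keys v. Poly_Mapping.single (g \<otimes>\<^bsub>G\<^esub> h)
           (Poly_Mapping.lookup u g * Poly_Mapping.lookup v h * \<alpha> g h))" for g
    using assms by (intro sum.mono_neutral_right) (auto simp: in_keys_iff)
  then show ?thesis
    using assms unfolding twisted_group_ring_def
    by (auto intro!: sum.mono_neutral_left simp: in_keys_iff)
qed

lemma twisted_mult_single:
  "Poly_Mapping.single g a \<otimes>\<^bsub>twisted_group_ring G \<alpha>\<^esub> Poly_Mapping.single h b =
     Poly_Mapping.single (g \<otimes>\<^bsub>G\<^esub> h) (a * b * \<alpha> g h)"
  by (subst twisted_mult_superset[of "{g}" _ "{h}"]) auto

lemma twisted_mult_distrib:
  "(u + v) \<otimes>\<^bsub>twisted_group_ring G \<alpha>\<^esub> w =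
     u \<otimes>\<^bsub>twisted_group_ring G \<alpha>\<^esub> w + v \<otimes>\<^bsub>twisted_group_ring G \<alpha>\<^esub> w"
  "w \<otimes>\<^bsub>twisted_group_ring G \<alpha>\<^esub> (u + v) =
     w \<otimes>\<^bsub>twisted_group_ring G \<alpha>\<^esub> u + w \<otimes>\<^bsub>twisted_group_ring G \<alpha>\<^esub> v"
proof -
  let ?S = "Poly_Mapping.keys u \<union> Poly_Mapping.keys v" and ?W = "Poly_Mapping.keys w"
  have S: "Poly_Mapping.keys u \<subseteq> ?S" "Poly_Mapping.keys v \<subseteq> ?S" "Poly_Mapping.keys (u + v) \<subseteq> ?S"
    using keys_add[of u v] by auto
  show "(u + v) \<otimes>\<^bsub>twisted_group_ring G \<alpha>\<^esub> w =
     u \<otimes>\<^bsub>twisted_group_ring G \<alpha>\<^esub> w + v \<otimes>\<^bsub>twisted_group_ring G \<alpha>\<^esub> w"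
    by (subst (1 2 3) twisted_mult_superset[of ?S _ ?W])
       (use S in \<open>simp_all add: lookup_add distrib_left distrib_right single_add sum.distrib\<close>)
  show "w \<otimes>\<^bsub>twisted_group_ring G \<alpha>\<^esub> (u + v) =
     w \<otimes>\<^bsub>twisted_group_ring G \<alpha>\<^esub> u + w \<otimes>\<^bsub>twisted_group_ring G \<alpha>\<^esub> v"
    by (subst (1 2 3) twisted_mult_superset[of ?W _ ?S])
       (use S in \<open>simp_all add: lookup_add distrib_left distrib_right single_add sum.distrib\<close>)
qed

lemma twisted_smult_mult:
  "(c \<odot>\<^bsub>twisted_group_ring G \<alpha>\<^esub> u) \<otimes>\<^bsub>twisted_group_ring G \<alpha>\<^esub> v =
     c \<odot>\<^bsub>twisted_group_ring G \<alpha>\<^esub> (u \<otimes>\<^bsub>twisted_group_ring G \<alpha>\<^esub> v)"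
  "u \<otimes>\<^bsub>twisted_group_ring G \<alpha>\<^esub> (c \<odot>\<^bsub>twisted_group_ring G \<alpha>\<^esub> v) =
     c \<odot>\<^bsub>twisted_group_ring G \<alpha>\<^esub> (u \<otimes>\<^bsub>twisted_group_ring G \<alpha>\<^esub> v)"
proof -
  have keys: "Poly_Mapping.keys (c \<odot>\<^bsub>twisted_group_ring G \<alpha>\<^esub> u) \<subseteq> Poly_Mapping.keys u" for u
    by (auto simp: in_keys_iff lookup_twisted_smult)
  note eqs = twisted_mult_superset[of "Poly_Mapping.keys u" _ "Poly_Mapping.keys v"]
  show "(c \<odot>\<^bsub>twisted_group_ring G \<alpha>\<^esub> u) \<otimes>\<^bsub>twisted_group_ring G \<alpha>\<^esub> v =
     c \<odot>\<^bsub>twisted_group_ring G \<alpha>\<^esub> (u \<otimes>\<^bsub>twisted_group_ring G \<alpha>\<^esub> v)"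
    by (rule poly_mapping_eqI, subst (1 2) eqs)
       (use keys in \<open>auto simp: lookup_sum lookup_twisted_smult sum_distrib_left lookup_single when_def
          intro!: sum.cong\<close>)
  show "u \<otimes>\<^bsub>twisted_group_ring G \<alpha>\<^esub> (c \<odot>\<^bsub>twisted_group_ring G \<alpha>\<^esub> v) =
     c \<odot>\<^bsub>twisted_group_ring G \<alpha>\<^esub> (u \<otimes>\<^bsub>twisted_group_ring G \<alpha>\<^esub> v)"
    by (rule poly_mapping_eqI, subst (1 2) eqs)
       (use keys in \<open>auto simp: lookup_sum lookup_twisted_smult sum_distrib_left lookup_single when_def
          intro!: sum.cong\<close>)
qed

lemma poly_mapping_carrier_induct [consumes 1, case_names zero single add]:
  fixes u :: "'g \<Rightarrow>\<^sub>0 'f::comm_monoid_add"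
  assumes "Poly_Mapping.keys u \<subseteq> S"
    and "P 0" and "\<And>g c. g \<in> S \<Longrightarrow> P (Poly_Mapping.single g c)"
    and "\<And>u v. P u \<Longrightarrow> P v \<Longrightarrow> P (u + v)"
  shows "P u"
proof -
  have "P (\<Sum>g\<in>F. Poly_Mapping.single g (Poly_Mapping.lookup u g))" if "finite F" "F \<subseteq> S" for F
    using that by (induction F rule: finite_induct) (auto intro: assms(2-))
  moreover have "(\<Sum>g\<in>Poly_Mapping.keys u. Poly_Mapping.single g (Poly_Mapping.lookup u g)) = u"
    by (rule poly_mapping_eqI) (simp add: lookup_sum lookup_single when_def in_keys_iff)
  ultimately show ?thesis using assms(1) by (metis finite_keys)
qed

text \<open>
  By bilinearity it suffices to look at basis elements, where associativity is the cocycle identity.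
\<close>

lemma twisted_group_ring_assoc_algebra:
  fixes G :: "('g, 'm) monoid_scheme" and \<alpha> :: "'g \<Rightarrow> 'g \<Rightarrow> 'f::field"
  assumes "group G" and "normalized_cocycle G \<alpha>"
  shows "assoc_algebra (class_ring :: 'f ring) (twisted_group_ring G \<alpha>)"
proof -
  interpret group G by fact
  let ?A = "twisted_group_ring G \<alpha>"
  have cocycle: "\<alpha> x y * \<alpha> (x \<otimes>\<^bsub>G\<^esub> y) z = \<alpha> y z * \<alpha> x (y \<otimes>\<^bsub>G\<^esub> z)"
    if "x \<in> carrier G" "y \<in> carrier G" "z \<in> carrier G" for x y z
    using assms(2) that by (auto simp: normalized_cocycle_def two_cocycle_def)
  have unit: "\<alpha> \<one>\<^bsub>G\<^esub> g = 1" "\<alpha> g \<one>\<^bsub>G\<^esub> = 1" if "g \<in> carrier G" for g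
    using assms(2) that by (auto simp: normalized_cocycle_def)
  have zero: "0 \<otimes>\<^bsub>?A\<^esub> u = 0" "u \<otimes>\<^bsub>?A\<^esub> 0 = 0" for u
    by (simp_all add: twisted_group_ring_def)
  have plus: "Poly_Mapping.keys (u + v) \<subseteq> carrier G"
    if "Poly_Mapping.keys u \<subseteq> carrier G" "Poly_Mapping.keys v \<subseteq> carrier G"
    for u v :: "'g \<Rightarrow>\<^sub>0 'f"
    using that keys_add[of u v] by blast
  have closed: "Poly_Mapping.keys (u \<otimes>\<^bsub>?A\<^esub> v) \<subseteq> carrier G"
    if u: "Poly_Mapping.keys u \<subseteq> carrier G" and v: "Poly_Mapping.keys v \<subseteq> carrier G" for u v
    using u
  proof (induction u rule: poly_mapping_carrier_induct)
    case (single g c)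
    from v single show ?case
      by (induction v rule: poly_mapping_carrier_induct)
         (simp_all add: zero twisted_mult_single twisted_mult_distrib plus)
  qed (simp_all add: zero twisted_mult_distrib plus)
  have assoc: "u \<otimes>\<^bsub>?A\<^esub> v \<otimes>\<^bsub>?A\<^esub> w = u \<otimes>\<^bsub>?A\<^esub> (v \<otimes>\<^bsub>?A\<^esub> w)"
    if u: "Poly_Mapping.keys u \<subseteq> carrier G" and v: "Poly_Mapping.keys v \<subseteq> carrier G"
      and w: "Poly_Mapping.keys w \<subseteq> carrier G" for u v w
    using u
  proof (induction u rule: poly_mapping_carrier_induct)
    case (single g a)
    from v single show ?case
    proof (induction v rule: poly_mapping_carrier_induct)
      case (single h b)
      from w single show ?case
      proof (induction w rule: poly_mapping_carrier_induct)
        case (single k c)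
        have "a * b * \<alpha> g h * c * \<alpha> (g \<otimes>\<^bsub>G\<^esub> h) k = a * b * c * (\<alpha> g h * \<alpha> (g \<otimes>\<^bsub>G\<^esub> h) k)"
          by (simp only: mult_ac)
        also have "\<dots> = a * b * c * (\<alpha> h k * \<alpha> g (h \<otimes>\<^bsub>G\<^esub> k))"
          using single by (simp only: cocycle)
        also have "\<dots> = a * (b * c * \<alpha> h k) * \<alpha> g (h \<otimes>\<^bsub>G\<^esub> k)"
          by (simp only: mult_ac)
        finally show ?case
          using single by (simp only: twisted_mult_single m_assoc)
      qed (simp_all add: zero twisted_mult_distrib)
    qed (simp_all add: zero twisted_mult_distrib)
  qed (simp_all add: zero twisted_mult_distrib)
  have one: "\<one>\<^bsub>?A\<^esub> \<otimes>\<^bsub>?A\<^esub> u = u" "u \<otimes>\<^bsub>?A\<^esub> \<one>\<^bsub>?A\<^esub> = u"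
    if "Poly_Mapping.keys u \<subseteq> carrier G" for u
    using that
    by (induction u rule: poly_mapping_carrier_induct)
       (simp_all add: zero twisted_mult_distrib twisted_group_ring_simps twisted_mult_single unit)
  have abelian: "abelian_group ?A"
  proof (rule abelian_groupI)
    fix u assume "u \<in> carrier ?A"
    then show "\<exists>v \<in> carrier ?A. v \<oplus>\<^bsub>?A\<^esub> u = \<zero>\<^bsub>?A\<^esub>"
      by (intro bexI[of _ "- u"]) (auto simp: twisted_group_ring_simps in_keys_iff)
  qed (simp_all add: twisted_group_ring_simps add_ac plus)
  have "Module.module (class_ring :: 'f ring) ?A"
    by (rule moduleI)
       (auto intro!: abelian poly_mapping_eqI class_cring.is_cring
         simp: twisted_group_ring_simps in_keys_iff lookup_twisted_smult lookup_add algebra_simps)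
  moreover have "ring ?A"
  proof (rule ringI)
    show "monoid ?A"
      by (rule monoidI)
         (use closed assoc one in \<open>auto simp: twisted_group_ring_simps(1) twisted_group_ring_simps(4)[symmetric]\<close>,
          auto simp: twisted_group_ring_simps)
  qed (auto intro: abelian simp: twisted_group_ring_simps twisted_mult_distrib)
  moreover have "assoc_algebra_axioms (class_ring :: 'f ring) ?A"
    by (rule assoc_algebra_axioms.intro) (simp_all add: twisted_smult_mult)
  ultimately show ?thesis by (rule assoc_algebra.intro)
qed

section \<open>Dihedral groups\<close>

text \<open>
  Rotations \<open>R i = r^i\<close> and reflections \<open>S i = r^i s\<close> are indexed by all integers modulo \<open>n\<close>, so
  that the multiplication table is free of case distinctions.
\<close>

locale dihedral = group G for G :: "('g, 'm) monoid_scheme" (structure) +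
  fixes n :: nat and R S :: "int \<Rightarrow> 'g"
  assumes n_pos: "n > 0"
    and R_closed: "R i \<in> carrier G" and S_closed: "S i \<in> carrier G"
    and R_0: "R 0 = \<one>"
    and R_mod: "R (i mod int n) = R i" and S_mod: "S (i mod int n) = S i"
    and RR: "R i \<otimes> R j = R (i + j)" and RS: "R i \<otimes> S j = S (i + j)"
    and SR: "S i \<otimes> R j = S (i - j)" and SS: "S i \<otimes> S j = R (i - j)"
    and carrier_eq: "carrier G = R ` {0..<int n} \<union> S ` {0..<int n}"
    and inj_R: "inj_on R {0..<int n}" and inj_S: "inj_on S {0..<int n}"
    and disjoint: "R ` {0..<int n} \<inter> S ` {0..<int n} = {}"
begin

lemma R_eq_iff: "R i = R j \<longleftrightarrow> int n dvd i - j"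
proof -
  have "R i = R j \<longleftrightarrow> R (i mod int n) = R (j mod int n)" by (simp add: R_mod)
  also have "\<dots> \<longleftrightarrow> i mod int n = j mod int n"
    using n_pos by (intro inj_on_eq_iff[OF inj_R]) auto
  finally show ?thesis by (simp add: mod_eq_dvd_iff)
qed

lemma S_eq_iff: "S i = S j \<longleftrightarrow> int n dvd i - j"
proof -
  have "S i = S j \<longleftrightarrow> S (i mod int n) = S (j mod int n)" by (simp add: S_mod)
  also have "\<dots> \<longleftrightarrow> i mod int n = j mod int n"
    using n_pos by (intro inj_on_eq_iff[OF inj_S]) auto
  finally show ?thesis by (simp add: mod_eq_dvd_iff)
qed

lemma R_neq_S: "R i \<noteq> S j"
proof -
  have "R (i mod int n) \<in> R ` {0..<int n}" "S (j mod int n) \<in> S ` {0..<int n}"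
    using n_pos by auto
  then have "R (i mod int n) \<noteq> S (j mod int n)" using disjoint by force
  then show ?thesis by (simp add: R_mod S_mod)
qed

lemma finite_carrier: "finite (carrier G)"
  by (simp add: carrier_eq)

lemma sum_carrier:
  "(\<Sum>g\<in>carrier G. h g) = (\<Sum>i\<in>{0..<int n}. h (R i)) + (\<Sum>i\<in>{0..<int n}. h (S i))"
  unfolding carrier_eq using disjoint
  by (subst sum.union_disjoint) (simp_all add: sum.reindex inj_R inj_S o_def)

end

text \<open>
  The relations give the multiplication table and show that the generated group consists of the
  \<open>R i\<close> and \<open>S i\<close> with \<open>0 \<le> i < n\<close>. These are at most \<open>2 n\<close> elements, so that the order
  of the group forces them to be distinct.
\<close>

lemma dihedral_group_dihedral:
  assumes "dihedral_group n G" and n: "n > 0"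
  obtains R S where "dihedral G n R S"
proof -
  interpret group G using assms by (simp add: dihedral_group_def)
  obtain r s where r: "r \<in> carrier G" and s: "s \<in> carrier G" and gen: "generate G {r, s} = carrier G"
    and rn: "r [^]\<^bsub>G\<^esub> n = \<one>\<^bsub>G\<^esub>" and s2: "s [^]\<^bsub>G\<^esub> (2::nat) = \<one>\<^bsub>G\<^esub>"
    and rs2: "(r \<otimes>\<^bsub>G\<^esub> s) [^]\<^bsub>G\<^esub> (2::nat) = \<one>\<^bsub>G\<^esub>"
    and order: "Coset.order G = 2 * n"
    using assms by (auto simp: dihedral_group_def)
  define R where "R i = r [^]\<^bsub>G\<^esub> i" for i :: int
  define S where "S i = R i \<otimes>\<^bsub>G\<^esub> s" for i :: int
  have R[simp]: "R i \<in> carrier G" and S[simp]: "S i \<in> carrier G" for i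
    using r s by (auto simp: R_def S_def)
  have R0: "R 0 = \<one>\<^bsub>G\<^esub>" by (simp add: R_def)
  have RR: "R i \<otimes>\<^bsub>G\<^esub> R j = R (i + j)" for i j
    using r by (simp add: R_def int_pow_mult)
  have ss: "s \<otimes>\<^bsub>G\<^esub> s = \<one>\<^bsub>G\<^esub>" using s2 s by (simp add: numeral_2_eq_2)
  have srs: "r \<otimes>\<^bsub>G\<^esub> s \<otimes>\<^bsub>G\<^esub> r \<otimes>\<^bsub>G\<^esub> s = \<one>\<^bsub>G\<^esub>"
    using rs2 r s by (simp add: numeral_2_eq_2 m_assoc)
  have R1: "R 1 = r" using r by (simp add: R_def)
  have conj: "R 1 \<otimes>\<^bsub>G\<^esub> s \<otimes>\<^bsub>G\<^esub> R 1 = s"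
  proof -
    have "r \<otimes>\<^bsub>G\<^esub> s \<otimes>\<^bsub>G\<^esub> r = r \<otimes>\<^bsub>G\<^esub> s \<otimes>\<^bsub>G\<^esub> r \<otimes>\<^bsub>G\<^esub> (s \<otimes>\<^bsub>G\<^esub> s)" using r s by (simp add: ss)
    also have "\<dots> = (r \<otimes>\<^bsub>G\<^esub> s \<otimes>\<^bsub>G\<^esub> r \<otimes>\<^bsub>G\<^esub> s) \<otimes>\<^bsub>G\<^esub> s" using r s by (simp add: m_assoc)
    finally show ?thesis using s by (simp add: srs R1)
  qed
  have conj_nat: "R (int k) \<otimes>\<^bsub>G\<^esub> s \<otimes>\<^bsub>G\<^esub> R (int k) = s" for k
  proof (induction k)
    case (Suc k)
    have "R (int (Suc k)) = R (int k) \<otimes>\<^bsub>G\<^esub> R 1" "R (int (Suc k)) = R 1 \<otimes>\<^bsub>G\<^esub> R (int k)"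
      by (simp_all add: RR add.commute)
    then have "R (int (Suc k)) \<otimes>\<^bsub>G\<^esub> s \<otimes>\<^bsub>G\<^esub> R (int (Suc k)) =
        R (int k) \<otimes>\<^bsub>G\<^esub> (R 1 \<otimes>\<^bsub>G\<^esub> s \<otimes>\<^bsub>G\<^esub> R 1) \<otimes>\<^bsub>G\<^esub> R (int k)"
      using s by (simp add: m_assoc del: of_nat_Suc)
    then show ?case by (simp add: conj Suc)
  qed (use s in \<open>simp add: R0\<close>)
  have comm: "s \<otimes>\<^bsub>G\<^esub> R i = R (- i) \<otimes>\<^bsub>G\<^esub> s" for i
  proof -
    have conj_int: "R i \<otimes>\<^bsub>G\<^esub> s \<otimes>\<^bsub>G\<^esub> R i = s"
    proof (cases "i \<ge> 0")
      case True
      then show ?thesis using conj_nat[of "nat i"] by simp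
    next
      case False
      define k where "k = nat (- i)"
      have i: "i = - int k" using False by (simp add: k_def)
      have "R i \<otimes>\<^bsub>G\<^esub> s \<otimes>\<^bsub>G\<^esub> R i = R i \<otimes>\<^bsub>G\<^esub> (R (int k) \<otimes>\<^bsub>G\<^esub> s \<otimes>\<^bsub>G\<^esub> R (int k)) \<otimes>\<^bsub>G\<^esub> R i"
        by (simp add: conj_nat)
      also have "\<dots> = (R i \<otimes>\<^bsub>G\<^esub> R (int k)) \<otimes>\<^bsub>G\<^esub> s \<otimes>\<^bsub>G\<^esub> (R (int k) \<otimes>\<^bsub>G\<^esub> R i)"
        using s by (simp add: m_assoc)
      finally show ?thesis using s by (simp add: RR i R0)
    qed
    have "R (- i) \<otimes>\<^bsub>G\<^esub> s = R (- i) \<otimes>\<^bsub>G\<^esub> (R i \<otimes>\<^bsub>G\<^esub> s \<otimes>\<^bsub>G\<^esub> R i)" by (simp add: conj_int)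
    also have "\<dots> = (R (- i) \<otimes>\<^bsub>G\<^esub> R i) \<otimes>\<^bsub>G\<^esub> s \<otimes>\<^bsub>G\<^esub> R i" using s by (simp add: m_assoc)
    finally show ?thesis using s by (simp add: RR R0)
  qed
  have RS: "R i \<otimes>\<^bsub>G\<^esub> S j = S (i + j)" for i j
    using s by (simp add: S_def m_assoc[symmetric] RR)
  have SR: "S i \<otimes>\<^bsub>G\<^esub> R j = S (i - j)" for i j
    using s by (simp add: S_def m_assoc comm) (simp add: m_assoc[symmetric] RR)
  have SS: "S i \<otimes>\<^bsub>G\<^esub> S j = R (i - j)" for i j
  proof -
    have "S i \<otimes>\<^bsub>G\<^esub> S j = (S i \<otimes>\<^bsub>G\<^esub> R j) \<otimes>\<^bsub>G\<^esub> s" using s by (simp add: S_def[of j] m_assoc)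
    also have "\<dots> = R (i - j) \<otimes>\<^bsub>G\<^esub> (s \<otimes>\<^bsub>G\<^esub> s)" using s by (simp add: SR) (simp add: S_def m_assoc)
    finally show ?thesis by (simp add: ss)
  qed
  have Rmod: "R (i mod int n) = R i" for i
  proof -
    have "R (int n * (i div int n)) = (r [^]\<^bsub>G\<^esub> int n) [^]\<^bsub>G\<^esub> (i div int n)"
      using r by (simp add: R_def int_pow_pow)
    also have "\<dots> = \<one>\<^bsub>G\<^esub>" by (simp add: int_pow_int rn)
    finally have "R (int n * (i div int n)) \<otimes>\<^bsub>G\<^esub> R (i mod int n) = R (i mod int n)" by simp
    then show ?thesis by (simp add: RR)
  qed
  have Smod: "S (i mod int n) = S i" for i by (simp add: S_def Rmod)
  let ?I = "{0..<int n}"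
  have R_in: "R i \<in> R ` ?I" and S_in: "S i \<in> S ` ?I" for i
    using n Rmod[of i, symmetric] Smod[of i, symmetric] by auto
  have "generate G {r, s} \<subseteq> R ` ?I \<union> S ` ?I"
  proof
    fix x assume "x \<in> generate G {r, s}"
    then show "x \<in> R ` ?I \<union> S ` ?I"
    proof (induction rule: generate.induct)
      case one
      show ?case using R_in[of 0] by (simp add: R0)
    next
      case (incl h)
      then show ?case using R_in[of 1] S_in[of 0] r s by (auto simp: R1 S_def R0)
    next
      case (inv h)
      have "inv\<^bsub>G\<^esub> r = R (- 1)" using r by (simp add: R_def int_pow_neg)
      moreover have "inv\<^bsub>G\<^esub> s = S 0" using s ss by (simp add: S_def R0 inv_equality)
      ultimately show ?case using inv R_in[of "- 1"] S_in[of 0] by auto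
    next
      case (eng h1 h2)
      then show ?case
        using R_in S_in by (auto simp: RR RS SR SS simp del: image_iff)
    qed
  qed
  then have carrier: "carrier G = R ` ?I \<union> S ` ?I" using gen by auto
  have card_le: "card (R ` ?I) \<le> n" "card (S ` ?I) \<le> n"
    using card_image_le[of ?I R] card_image_le[of ?I S] by simp_all
  have card: "card (R ` ?I \<union> S ` ?I) = 2 * n" using order by (simp add: Coset.order_def carrier)
  then have cards: "card (R ` ?I) = n" "card (S ` ?I) = n"
    using card_le card_Un_le[of "R ` ?I" "S ` ?I"] by auto
  then have "inj_on R ?I" "inj_on S ?I" by (auto intro!: eq_card_imp_inj_on)
  moreover have "card (R ` ?I \<inter> S ` ?I) = 0"
    using card_Un_Int[of "R ` ?I" "S ` ?I"] card cards by simp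
  then have "R ` ?I \<inter> S ` ?I = {}" by simp
  ultimately have "dihedral G n R S"
    by unfold_locales (use n R0 Rmod Smod RR RS SR SS carrier in auto)
  then show ?thesis using that by blast
qed

section \<open>Normal form of cocycles on dihedral groups\<close>

context assoc_algebra begin

lemma smult_power:
  assumes "c \<in> carrier K" "x \<in> carrier A"
  shows "(c \<odot> x) [^] (k::nat) = (c [^]\<^bsub>K\<^esub> k) \<odot> (x [^] k)"
proof (induction k)
  case (Suc k)
  have "(c \<odot> x) [^] Suc k = (c [^]\<^bsub>K\<^esub> k \<odot> x [^] k) \<otimes> (c \<odot> x)" by (simp add: Suc)
  also have "\<dots> = (c [^]\<^bsub>K\<^esub> k \<otimes>\<^bsub>K\<^esub> c) \<odot> (x [^] k \<otimes> x)"
    using assms by (simp add: smult_mult_left smult_mult_right smult_assoc1[symmetric] R.m_comm)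
  finally show ?case by simp
qed simp

lemma quasi_commute_power:
  assumes u: "u \<in> carrier A" and v: "v \<in> carrier A" and c: "c \<in> carrier K"
    and comm: "v \<otimes> u = c \<odot> (u [^] (m::nat) \<otimes> v)"
  shows "v \<otimes> u [^] (k::nat) = (c [^]\<^bsub>K\<^esub> k) \<odot> (u [^] (m * k) \<otimes> v)"
proof (induction k)
  case (Suc k)
  have "v \<otimes> u [^] Suc k = (v \<otimes> u [^] k) \<otimes> u" using u v by (simp add: m_assoc)
  also have "\<dots> = c [^]\<^bsub>K\<^esub> k \<odot> (u [^] (m * k) \<otimes> (v \<otimes> u))"
    using u v c by (simp add: Suc smult_mult_left m_assoc)
  also have "\<dots> = c [^]\<^bsub>K\<^esub> k \<odot> (c \<odot> (u [^] (m * k) \<otimes> u [^] m \<otimes> v))"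
    using u v c by (simp add: comm smult_mult_right m_assoc)
  also have "\<dots> = (c [^]\<^bsub>K\<^esub> Suc k) \<odot> (u [^] (m * Suc k) \<otimes> v)"
    using u v c by (simp add: smult_assoc1 nat_pow_mult add.commute)
  finally show ?case .
qed (use u v in simp)

end

text \<open>
  Put \<open>t = \<nu> \<kappa>\<close>. The hypothesis says \<open>\<nu>^2 = t^n\<close>, so for \<open>n = 2 m + 1\<close> the element
  \<open>\<nu> / t^m\<close> is a square root of \<open>t\<close>, and its \<open>n\<close>-th power is \<open>\<nu>\<close>. No root has to be
  adjoined to the field because \<open>n\<close> is odd.
\<close>

lemma odd_power_rescaling:
  fixes \<kappa> \<nu> :: "'f::field" and n :: nat
  assumes "odd n" "\<nu> \<noteq> 0" "\<kappa> \<noteq> 0" and eq: "\<nu> * \<nu> = \<kappa> ^ n * \<nu> ^ n"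
  obtains d where "d \<noteq> 0" "d ^ n = \<nu>" "d * d = \<nu> * \<kappa>"
proof -
  obtain m where n: "n = 2 * m + 1" using assms(1) by (auto elim: oddE)
  define t where "t = \<nu> * \<kappa>"
  define d where "d = \<nu> / t ^ m"
  have t: "t \<noteq> 0" using assms by (simp add: t_def)
  have "\<nu> * \<nu> = t ^ n" using eq by (simp add: t_def power_mult_distrib mult.commute)
  then have ll: "\<nu> * \<nu> = t * (t ^ m * t ^ m)" by (simp add: n power_add mult_2)
  have dd: "d * d = t" using ll t by (simp add: d_def)
  have "d ^ n = d * (d * d) ^ m" by (simp add: n power_mult power2_eq_square)
  also have "\<dots> = \<nu>" using t unfolding dd by (simp add: d_def)
  finally have "d ^ n = \<nu>" .
  with dd assms show ?thesis by (intro that[of d]) (auto simp: t_def d_def)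
qed


locale field_algebra = assoc_algebra "class_ring :: 'f ring" A
  for A :: "('f::field, 'a, 'm) module_scheme" (structure)
begin

lemma smult_right_cancel:
  assumes v: "v \<in> carrier A" "v \<noteq> \<zero>" and eq: "c \<odot> v = c' \<odot> v"
  shows "c = c'"
proof (rule ccontr)
  assume "c \<noteq> c'"
  have "(c + - c') \<odot> v = c \<odot> v \<oplus> (- c') \<odot> v"
    using v smult_l_distr[of c "- c'" v] by simp
  also have "\<dots> = (c' + - c') \<odot> v"
    using v smult_l_distr[of c' "- c'" v] by (simp add: eq)
  also have "\<dots> = \<zero>" using v smult_l_null[of v] by simp
  finally have "inverse (c + - c') \<odot> ((c + - c') \<odot> v) = \<zero>" by (simp add: smult_r_null)
  moreover have "inverse (c + - c') \<odot> ((c + - c') \<odot> v) = v"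
    using v \<open>c \<noteq> c'\<close> smult_assoc1[of "inverse (c + - c')" "c + - c'" v] smult_one[of v] by simp
  ultimately show False using v by simp
qed

text \<open>
  If \<open>u^n = \<nu>\<close> and \<open>v u = \<kappa> u^(n-1) v\<close>, then moving \<open>v\<close> past \<open>u^n\<close> gives
  \<open>\<nu> v = \<kappa>^n \<nu>^(n-1) v\<close>. This relation between \<open>\<nu>\<close> and \<open>\<kappa>\<close> is what allows one scalar to
  remove both of them.
\<close>

lemma rescale_rotation:
  fixes n :: nat
  assumes n: "odd n" and u: "u \<in> carrier A" and v: "v \<in> carrier A" "v \<noteq> \<zero>"
    and un: "u [^] n = \<nu> \<odot> \<one>" and comm: "v \<otimes> u = \<kappa> \<odot> (u [^] (n - 1) \<otimes> v)"
    and nz: "\<nu> \<noteq> 0" "\<kappa> \<noteq> 0"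
  obtains d where "d \<noteq> 0" "(d \<odot> u) [^] n = \<one>" "v \<otimes> (d \<odot> u) = (d \<odot> u) [^] (n - 1) \<otimes> v"
proof -
  obtain m where m: "n = Suc m" using n by (cases n) auto
  have pow: "x [^]\<^bsub>class_ring :: 'f ring\<^esub> k = x ^ k" for x k by (simp add: class_ring_simps)
  have "v \<otimes> u [^] n = \<kappa> ^ n \<odot> (u [^] ((n - 1) * n) \<otimes> v)"
    using quasi_commute_power[OF u v(1) _ comm, of n] by (simp add: pow)
  also have "(n - 1) * n = n * m" by (simp add: m)
  also have "u [^] (n * m) = (\<nu> \<odot> \<one>) [^] m"
    by (simp only: un[symmetric] nat_pow_pow[OF u])
  also have "\<dots> = \<nu> ^ m \<odot> \<one>" by (simp add: smult_power pow nat_pow_one)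
  finally have "\<nu> \<odot> v = (\<kappa> ^ n * \<nu> ^ m) \<odot> v"
    using v smult_assoc1[of "\<kappa> ^ n" "\<nu> ^ m" v] by (simp add: un smult_mult_left smult_mult_right)
  then have "\<nu> = \<kappa> ^ n * \<nu> ^ m" by (rule smult_right_cancel[OF v])
  then have "\<nu> * \<nu> = \<kappa> ^ n * \<nu> ^ n" by (metis m mult.assoc mult.commute power_Suc)
  then obtain d where d: "d \<noteq> 0" "d ^ n = \<nu>" "d * d = \<nu> * \<kappa>"
    using odd_power_rescaling[OF n nz] by blast
  let ?e = "inverse d"
  have "(?e \<odot> u) [^] n = ?e ^ n \<odot> (\<nu> \<odot> \<one>)" using u by (simp add: smult_power pow un)
  also have "\<dots> = (?e ^ n * \<nu>) \<odot> \<one>" using smult_assoc1[of "?e ^ n" \<nu> \<one>] by simp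
  also have "?e ^ n * \<nu> = 1" using d nz by (simp add: power_inverse)
  finally have 1: "(?e \<odot> u) [^] n = \<one>" using smult_one[of \<one>] by simp
  have "?e ^ m = ?e * \<kappa>"
  proof -
    have "d * d ^ m = \<nu>" using d by (simp add: m)
    then have "d * d ^ m * \<kappa> = d * d" using d by simp
    then have "d ^ m * \<kappa> = d" using d(1) by (simp add: mult.assoc)
    then show ?thesis using d(1) nz by (simp add: field_simps power_inverse)
  qed
  then have 2: "v \<otimes> (?e \<odot> u) = (?e \<odot> u) [^] (n - 1) \<otimes> v"
    using u v smult_assoc1[of ?e \<kappa> "u [^] m \<otimes> v"]
    by (simp add: smult_power pow m smult_mult_left smult_mult_right comm)
  show ?thesis using that[of ?e] d 1 2 by simp
qed

lemma dihedral_basis_products: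
  assumes n: "n > 0" and u: "u \<in> carrier A" and v: "v \<in> carrier A"
    and un: "u [^] n = \<one>" and comm: "v \<otimes> u = u [^] (n - 1) \<otimes> v" and vv: "v \<otimes> v = \<mu> \<odot> \<one>"
  defines "e \<equiv> (\<lambda>i. u [^] nat (i mod int n))"
  shows "e i \<otimes> e j = e (i + j)" "e i \<otimes> (e j \<otimes> v) = e (i + j) \<otimes> v"
    "(e i \<otimes> v) \<otimes> e j = e (i - j) \<otimes> v" "(e i \<otimes> v) \<otimes> (e j \<otimes> v) = \<mu> \<odot> e (i - j)"
proof -
  have e[simp]: "e i \<in> carrier A" for i using u by (simp add: e_def)
  have pow_mod: "u [^] k = e (int k)" for k
  proof -
    have "u [^] k = u [^] (n * (k div n) + k mod n)" by simp
    also have "\<dots> = (u [^] n) [^] (k div n) \<otimes> u [^] (k mod n)"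
      using u by (simp only: nat_pow_mult nat_pow_pow)
    finally show ?thesis using u by (simp add: un nat_pow_one e_def nat_mod_as_int)
  qed
  have e_mod: "e (i mod int n) = e i" for i by (simp add: e_def)
  have ee: "e i \<otimes> e j = e (i + j)" for i j
  proof -
    have "e i \<otimes> e j = u [^] (nat (i mod int n) + nat (j mod int n))"
      using u by (simp add: e_def nat_pow_mult)
    also have "\<dots> = e (i mod int n + j mod int n)" using n by (simp add: pow_mod)
    also have "\<dots> = e ((i mod int n + j mod int n) mod int n)" by (simp only: e_mod)
    also have "\<dots> = e (i + j)" by (simp only: mod_add_eq e_mod)
    finally show ?thesis .
  qed
  show "e i \<otimes> e j = e (i + j)" by (rule ee)
  show "e i \<otimes> (e j \<otimes> v) = e (i + j) \<otimes> v"
    using v by (simp add: m_assoc[symmetric] ee)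
  have ve: "v \<otimes> e j = e (- j) \<otimes> v" for j
  proof -
    define k where "k = nat (j mod int n)"
    have k: "int k = j mod int n" using n by (simp add: k_def)
    have "v \<otimes> u = \<one>\<^bsub>class_ring\<^esub> \<odot> (u [^] (n - 1) \<otimes> v)"
      using u v comm smult_one[of "u [^] (n - 1) \<otimes> v"] by simp
    from quasi_commute_power[OF u v _ this, of k]
    have "v \<otimes> u [^] k = u [^] ((n - 1) * k) \<otimes> v"
      using u v smult_one[of "u [^] ((n - 1) * k) \<otimes> v"] by (simp add: class_ring_simps)
    also have "u [^] ((n - 1) * k) = e (- j)"
    proof -
      have "int ((n - 1) * k) = - j + int n * (int k + j div int n)"
        using n k minus_mult_div_eq_mod[of j "int n"] by (simp add: algebra_simps of_nat_diff)
      then have "int ((n - 1) * k) mod int n = (- j) mod int n"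
        by (simp only: mod_mult_self2)
      then show ?thesis using e_mod[of "int ((n - 1) * k)"] e_mod[of "- j"] by (simp only: pow_mod)
    qed
    finally show ?thesis by (simp add: e_def k_def)
  qed
  show ev: "(e i \<otimes> v) \<otimes> e j = e (i - j) \<otimes> v" for i
    using v by (simp add: m_assoc ve) (simp add: m_assoc[symmetric] ee)
  have "(e i \<otimes> v) \<otimes> (e j \<otimes> v) = ((e i \<otimes> v) \<otimes> e j) \<otimes> v" using v by (simp add: m_assoc)
  also have "\<dots> = e (i - j) \<otimes> (v \<otimes> v)" using v by (simp add: ev m_assoc)
  finally show "(e i \<otimes> v) \<otimes> (e j \<otimes> v) = \<mu> \<odot> e (i - j)" by (simp add: vv smult_mult_right)
qed

end

context dihedral begin

text \<open>
  Rescaling the basis elements at \<open>R i\<close> by \<open>c i\<close> and at \<open>S i\<close> by \<open>t i\<close> turns the cocycle into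
  the constant \<open>\<mu>\<close> on pairs of reflections and \<open>1\<close> elsewhere: up to coboundaries, only the value
  \<open>\<mu> = v^2\<close> of the square of a reflection survives. The rescaled basis consists of the \<open>w^i\<close> and
  \<open>w^i v\<close>, where \<open>w\<close> is the multiple of the generating rotation that satisfies \<open>w^n = 1\<close> and
  \<open>v w = w^(n-1) v\<close>.
\<close>

lemma cocycle_normal_form:
  fixes \<alpha> :: "'g \<Rightarrow> 'g \<Rightarrow> 'f::field"
  assumes n: "odd n" and \<alpha>: "normalized_cocycle G \<alpha>"
  obtains \<mu> and c t :: "int \<Rightarrow> 'f" where
    "\<mu> \<noteq> 0" "\<And>i. c i \<noteq> 0" "\<And>i. t i \<noteq> 0" "c 0 = 1"
    "\<And>i. c (i mod int n) = c i" "\<And>i. t (i mod int n) = t i"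
    "\<And>i j. c i * c j * \<alpha> (R i) (R j) = c (i + j)" "\<And>i j. c i * t j * \<alpha> (R i) (S j) = t (i + j)"
    "\<And>i j. t i * c j * \<alpha> (S i) (R j) = t (i - j)" "\<And>i j. t i * t j * \<alpha> (S i) (S j) = \<mu> * c (i - j)"
proof -
  let ?A = "twisted_group_ring G \<alpha>"
  interpret A: assoc_algebra "class_ring :: 'f ring" ?A
    by (rule twisted_group_ring_assoc_algebra) (use \<alpha> is_group in auto)
  interpret A: field_algebra ?A ..
  have \<alpha>_nz: "\<alpha> x y \<noteq> 0" if "x \<in> carrier G" "y \<in> carrier G" for x y
    using \<alpha> that by (simp add: normalized_cocycle_def two_cocycle_def)
  have \<alpha>_R: "\<alpha> (R i) (R j) \<noteq> 0" "\<alpha> (R i) (S j) \<noteq> 0" "\<alpha> (S i) (R j) \<noteq> 0" "\<alpha> (S i) (S j) \<noteq> 0" for i j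
    by (simp_all add: \<alpha>_nz R_closed S_closed)
  have carrier: "Poly_Mapping.single g x \<in> carrier ?A" if "g \<in> carrier G" for g and x :: 'f
    using that by (simp add: twisted_group_ring_simps)
  have one: "\<one>\<^bsub>?A\<^esub> = Poly_Mapping.single (R 0) 1" by (simp add: twisted_group_ring_simps R_0)
  have smult: "x \<odot>\<^bsub>?A\<^esub> Poly_Mapping.single g y = Poly_Mapping.single g (x * y)" for x y :: 'f and g
    by (rule poly_mapping_eqI) (simp add: lookup_twisted_smult lookup_single when_def)
  define u where "u = Poly_Mapping.single (R 1) (1::'f)"
  define v where "v = Poly_Mapping.single (S 0) (1::'f)"
  have u: "u \<in> carrier ?A" and v: "v \<in> carrier ?A" "v \<noteq> \<zero>\<^bsub>?A\<^esub>"
    unfolding u_def v_def by (auto simp: carrier R_closed S_closed twisted_group_ring_simps(3))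
       (metis lookup_single_eq lookup_zero zero_neq_one)
  have pow: "\<exists>y. y \<noteq> 0 \<and> (Poly_Mapping.single (R 1) x) [^]\<^bsub>?A\<^esub> k = Poly_Mapping.single (R (int k)) y"
    if "x \<noteq> 0" for x :: 'f and k :: nat
  proof (induction k)
    case 0
    show ?case by (rule exI[of _ 1]) (simp add: one)
  next
    case (Suc k)
    then obtain y where y: "y \<noteq> 0" "(Poly_Mapping.single (R 1) x) [^]\<^bsub>?A\<^esub> k = Poly_Mapping.single (R (int k)) y"
      by blast
    show ?case
      by (rule exI[of _ "y * x * \<alpha> (R (int k)) (R 1)"])
         (simp add: y that \<alpha>_R twisted_mult_single RR add.commute)
  qed
  have R_n: "R (int n) = R 0" by (simp add: R_eq_iff)
  obtain \<nu> where \<nu>: "\<nu> \<noteq> 0" "u [^]\<^bsub>?A\<^esub> n = \<nu> \<odot>\<^bsub>?A\<^esub> \<one>\<^bsub>?A\<^esub>"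
    using pow[of 1 n] unfolding u_def one smult R_n by auto
  obtain z where z: "z \<noteq> 0" "u [^]\<^bsub>?A\<^esub> (n - 1) = Poly_Mapping.single (R (int (n - 1))) z"
    using pow[of 1 "n - 1"] unfolding u_def by auto
  have S_n: "S (int (n - Suc 0)) = S (- 1)" using n_pos by (simp add: S_eq_iff of_nat_diff)
  define \<kappa> where "\<kappa> = \<alpha> (S 0) (R 1) / (z * \<alpha> (R (int (n - 1))) (S 0))"
  have \<kappa>: "\<kappa> \<noteq> 0" by (simp add: \<kappa>_def z \<alpha>_R)
  have comm: "v \<otimes>\<^bsub>?A\<^esub> u = \<kappa> \<odot>\<^bsub>?A\<^esub> (u [^]\<^bsub>?A\<^esub> (n - 1) \<otimes>\<^bsub>?A\<^esub> v)"
    unfolding z(2) unfolding u_def v_def twisted_mult_single smult RS SR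
    by (simp add: \<kappa>_def z(1) \<alpha>_R S_n del: of_nat_diff)
  obtain d where d: "d \<noteq> 0" "(d \<odot>\<^bsub>?A\<^esub> u) [^]\<^bsub>?A\<^esub> n = \<one>\<^bsub>?A\<^esub>"
      "v \<otimes>\<^bsub>?A\<^esub> (d \<odot>\<^bsub>?A\<^esub> u) = (d \<odot>\<^bsub>?A\<^esub> u) [^]\<^bsub>?A\<^esub> (n - 1) \<otimes>\<^bsub>?A\<^esub> v"
    using A.rescale_rotation[OF n u v \<nu>(2) comm \<nu>(1) \<kappa>] by blast
  define w where "w = d \<odot>\<^bsub>?A\<^esub> u"
  have w: "w = Poly_Mapping.single (R 1) d" by (simp add: w_def u_def smult)
  have w_closed: "w \<in> carrier ?A" by (simp add: w carrier R_closed)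
  define \<mu> where "\<mu> = \<alpha> (S 0) (S 0)"
  have vv: "v \<otimes>\<^bsub>?A\<^esub> v = \<mu> \<odot>\<^bsub>?A\<^esub> \<one>\<^bsub>?A\<^esub>"
    by (simp add: v_def twisted_mult_single one smult SS \<mu>_def)
  define e where "e i = w [^]\<^bsub>?A\<^esub> nat (i mod int n)" for i
  note products = A.dihedral_basis_products[OF n_pos w_closed v(1) d(2,3)[folded w_def] vv, folded e_def]
  have e_single: "\<exists>y. y \<noteq> 0 \<and> e i = Poly_Mapping.single (R i) y" for i
    using pow[OF d(1), of "nat (i mod int n)"] n_pos by (simp add: e_def w R_mod)
  define c where "c i = Poly_Mapping.lookup (e i) (R i)" for i
  have c: "e i = Poly_Mapping.single (R i) (c i)" "c i \<noteq> 0" for i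
    using e_single[of i] by (auto simp: c_def)
  define t where "t i = c i * \<alpha> (R i) (S 0)" for i
  have t: "e i \<otimes>\<^bsub>?A\<^esub> v = Poly_Mapping.single (S i) (t i)" for i
    by (simp add: c(1) v_def twisted_mult_single RS t_def)
  have e_mod: "e (i mod int n) = e i" for i by (simp add: e_def)
  have c_mod: "c (i mod int n) = c i" for i by (simp add: c_def e_mod R_mod)
  have single_eqD: "x = y" if "Poly_Mapping.single g x = Poly_Mapping.single g y" for g :: 'g and x y :: 'f
    using arg_cong[OF that, of "\<lambda>p. Poly_Mapping.lookup p g"] by simp
  show ?thesis
  proof (rule that[of \<mu> c t])
    show "\<mu> \<noteq> 0" by (simp add: \<mu>_def \<alpha>_R)
    show "c i \<noteq> 0" "t i \<noteq> 0" for i by (simp_all add: c(2) t_def \<alpha>_R)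
    have "e 0 = \<one>\<^bsub>?A\<^esub>" by (simp add: e_def)
    then show "c 0 = 1" by (simp add: c_def one)
    show "c (i mod int n) = c i" "t (i mod int n) = t i" for i
      by (simp_all add: c_mod t_def R_mod)
    show "c i * c j * \<alpha> (R i) (R j) = c (i + j)" for i j
      using products(1)[of i j] by (auto simp: c(1) twisted_mult_single RR dest!: single_eqD)
    show "c i * t j * \<alpha> (R i) (S j) = t (i + j)" for i j
      using products(2)[of i j] unfolding t by (auto simp: c(1) twisted_mult_single RS dest!: single_eqD)
    show "t i * c j * \<alpha> (S i) (R j) = t (i - j)" for i j
      using products(3)[of i j] unfolding t by (auto simp: c(1) twisted_mult_single SR dest!: single_eqD)
    show "t i * t j * \<alpha> (S i) (S j) = \<mu> * c (i - j)" for i j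
      using products(4)[of i j] unfolding t by (auto simp: c(1) twisted_mult_single SS smult dest!: single_eqD)
  qed
qed

end

section \<open>Functions on the integers modulo an odd number\<close>

lemma sum_residues_delta:
  fixes h :: "int \<Rightarrow> 'f::comm_semiring_1"
  assumes n: "n > 0" and h: "\<And>k. h (k mod int n) = h k" and d: "\<And>i. P i \<longleftrightarrow> int n dvd i - c"
  shows "(\<Sum>i\<in>{0..<int n}. of_bool (P i) * h i) = h c"
proof -
  have "P i \<longleftrightarrow> i = c mod int n" if "i \<in> {0..<int n}" for i
    using that by (simp add: d mod_eq_dvd_iff[symmetric])
  then have "(\<Sum>i\<in>{0..<int n}. of_bool (P i) * h i) = (\<Sum>i\<in>{0..<int n}. if i = c mod int n then h i else 0)"
    by (intro sum.cong) auto
  also have "\<dots> = h (c mod int n)" using n by (simp add: sum.delta)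
  finally show ?thesis by (simp add: h)
qed

lemma sum_residues_reflect:
  fixes h :: "int \<Rightarrow> 'f::comm_monoid_add"
  assumes n: "n > 0" and h: "\<And>k. h (k mod int n) = h k"
  shows "(\<Sum>i\<in>{0..<int n}. h (c - i)) = (\<Sum>i\<in>{0..<int n}. h i)"
  by (rule sum.reindex_bij_witness[of _ "\<lambda>i. (c - i) mod int n" "\<lambda>i. (c - i) mod int n"])
     (use n h in \<open>auto simp: mod_simps\<close>)

text \<open>
  The numbers \<open>1, 3, \<dots>, 2 n - 1\<close> represent all residues, and the values of \<open>y\<close> at them sum to
  zero since \<open>y\<close> is an odd function. Hence the partial sums \<open>S\<close> are well defined modulo \<open>n\<close>, with
  \<open>S (j + 1) - S j = y (2 j + 1)\<close>; the function \<open>j \<mapsto> S (- j)\<close> satisfies the same recursion, so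
  \<open>S\<close> is even. Substituting \<open>k / 2\<close> modulo \<open>n\<close> gives the solution.
\<close>

lemma symmetric_primitive_mod_odd:
  fixes y :: "int \<Rightarrow> 'f::field"
  assumes n: "odd n" and two: "(2::'f) \<noteq> 0"
    and y: "\<And>k. y (k mod int n) = y k" and anti: "\<And>k. y (- k) = - y k"
  shows "\<exists>\<epsilon>. (\<forall>k. \<epsilon> (k mod int n) = \<epsilon> k) \<and> (\<forall>k. \<epsilon> (- k) = \<epsilon> k) \<and>
    (\<forall>k. \<epsilon> (k + 1) - \<epsilon> (k - 1) = y k)"
proof -
  have n0: "n > 0" using n by (cases n) auto
  have y_cong: "y k = y l" if "k mod int n = l mod int n" for k l
    using y[of k] y[of l] that by simp
  define S where "S j = (\<Sum>t\<in>{0..<j mod int n}. y (2 * t + 1))" for j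
  have total: "(\<Sum>t\<in>{0..<int n}. y (2 * t + 1)) = 0"
  proof -
    have "(\<Sum>t\<in>{0..<int n}. y (2 * t + 1)) = (\<Sum>t\<in>{0..<int n}. y (2 * (- 1 - t) + 1))"
      using n0 by (intro sum_residues_reflect[symmetric] y_cong)
        (simp, metis mod_add_left_eq mod_mult_right_eq)
    also have "\<dots> = - (\<Sum>t\<in>{0..<int n}. y (2 * t + 1))"
      by (simp only: sum_negf[symmetric] anti[symmetric]) (simp add: algebra_simps)
    finally have "2 * (\<Sum>t\<in>{0..<int n}. y (2 * t + 1)) = 0" by simp
    then show ?thesis using two by simp
  qed
  have S_cong: "S j = S l" if "j mod int n = l mod int n" for j l using that by (simp add: S_def)
  have step: "S (j + 1) = S j + y (2 * j + 1)" for j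
  proof -
    define a where "a = j mod int n"
    have a: "0 \<le> a" "a < int n" using n0 by (simp_all add: a_def)
    have "S j + y (2 * j + 1) = (\<Sum>t\<in>{0..<a}. y (2 * t + 1)) + y (2 * a + 1)"
      by (simp add: S_def a_def) (rule y_cong, metis mod_add_left_eq mod_mult_right_eq)
    also have "\<dots> = (\<Sum>t\<in>{0..<a + 1}. y (2 * t + 1))"
    proof -
      have "{0..<a + 1} = insert a {0..<a}" using a by auto
      then show ?thesis by (simp add: add.commute)
    qed
    also have "\<dots> = S (j + 1)"
    proof (cases "a + 1 = int n")
      case True
      then have "(j + 1) mod int n = 0" by (metis a_def mod_add_left_eq mod_self)
      then show ?thesis using True total by (simp add: S_def)
    next
      case False
      then have "(j + 1) mod int n = a + 1" using a by (metis a_def mod_add_left_eq mod_pos_pos_trivial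
          add_nonneg_nonneg zero_le_one less_le zless_imp_add1_zle)
      then show ?thesis by (simp add: S_def)
    qed
    finally show ?thesis by simp
  qed
  have S_nat: "S (- int j) = S (int j)" for j
  proof (induction j)
    case (Suc j)
    have neg: "- int (Suc j) + 1 = - int j" "2 * - int (Suc j) + 1 = - (2 * int j + 1)" by simp_all
    have "S (- int j) = S (- int (Suc j)) - y (2 * int j + 1)"
      using step[of "- int (Suc j)"] unfolding neg anti by simp
    moreover have "S (int (Suc j)) = S (int j) + y (2 * int j + 1)"
      using step[of "int j"] by (simp add: add.commute)
    ultimately show ?case using Suc by simp
  qed simp
  have S_sym: "S (- j) = S j" for j
    using S_nat[of "nat j"] S_nat[of "nat (- j)"] by (cases "j \<ge> 0") auto
  \<comment> \<open>The inverse of 2 modulo \<open>n\<close>.\<close>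
  define h where "h = (int n + 1) div 2"
  have h: "2 * h = int n + 1"
    unfolding h_def using n by presburger
  define \<epsilon> where "\<epsilon> i = S (h * i)" for i
  have "\<epsilon> (k mod int n) = \<epsilon> k" for k unfolding \<epsilon>_def by (rule S_cong) (simp add: mod_simps)
  moreover have "\<epsilon> (- k) = \<epsilon> k" for k by (simp add: \<epsilon>_def S_sym)
  moreover have "\<epsilon> (k + 1) - \<epsilon> (k - 1) = y k" for k
  proof -
    have "h * (k + 1) = (h * (k - 1) + 1) + int n" using h by (simp add: algebra_simps)
    then have "\<epsilon> (k + 1) = S (h * (k - 1) + 1)" unfolding \<epsilon>_def by (intro S_cong) simp
    also have "\<dots> = \<epsilon> (k - 1) + y (2 * (h * (k - 1)) + 1)" by (simp add: step \<epsilon>_def)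
    also have "2 * (h * (k - 1)) + 1 = (2 * h) * (k - 1) + 1" by simp
    also have "\<dots> = k + int n * (k - 1)" unfolding h by (simp add: algebra_simps)
    also have "y \<dots> = y k" by (rule y_cong) simp
    finally show ?thesis by simp
  qed
  ultimately show ?thesis by blast
qed

section \<open>Derivations of algebras with a dihedral basis\<close>

text \<open>
  An algebra with basis \<open>u^i\<close>, \<open>u^i v\<close> (\<open>i\<close> modulo \<open>n\<close>), where \<open>u^n = 1\<close>, \<open>v^2 = \<mu>\<close> and
  \<open>v u = u^(-1) v\<close>, is described by its coordinate functions: \<open>X a i\<close> is the coefficient of \<open>u^i\<close>
  in \<open>a\<close> and \<open>Y a i\<close> that of \<open>u^i v\<close>. The coordinates of a product are twisted convolutions over
  the integers modulo \<open>n\<close>, and every identity that is linear in the algebra becomes an identity of scalars.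
\<close>

locale dihedral_algebra = field_algebra A
  for A :: "('f::field, 'a, 'm) module_scheme" (structure) +
  fixes n :: nat and \<mu> :: 'f and X Y :: "'a \<Rightarrow> int \<Rightarrow> 'f"
  assumes odd_n: "odd n" and of_nat_n: "of_nat n = (0::'f)" and \<mu>: "\<mu> \<noteq> 0"
    and X_mod: "X a (k mod int n) = X a k" and Y_mod: "Y a (k mod int n) = Y a k"
    and coords_exist: "(\<And>k. x (k mod int n) = x k) \<Longrightarrow> (\<And>k. y (k mod int n) = y k) \<Longrightarrow>
        \<exists>a \<in> carrier A. X a = x \<and> Y a = y"
    and coords_eqI: "a \<in> carrier A \<Longrightarrow> b \<in> carrier A \<Longrightarrow>
        (\<And>k. X a k = X b k) \<Longrightarrow> (\<And>k. Y a k = Y b k) \<Longrightarrow> a = b"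
    and X_add: "X (a \<oplus> b) k = X a k + X b k" and Y_add: "Y (a \<oplus> b) k = Y a k + Y b k"
    and X_smult: "X (c \<odot> a) k = c * X a k" and Y_smult: "Y (c \<odot> a) k = c * Y a k"
    and X_one: "X \<one> k = of_bool (int n dvd k)" and Y_one: "Y \<one> k = 0"
    and X_mult: "a \<in> carrier A \<Longrightarrow> b \<in> carrier A \<Longrightarrow> X (a \<otimes> b) k =
        (\<Sum>i\<in>{0..<int n}. X a i * X b (k - i) + \<mu> * (Y a i * Y b (i - k)))"
    and Y_mult: "a \<in> carrier A \<Longrightarrow> b \<in> carrier A \<Longrightarrow> Y (a \<otimes> b) k =
        (\<Sum>i\<in>{0..<int n}. X a i * Y b (k - i) + Y a i * X b (i - k))"
begin

lemma n_pos: "n > 0" using odd_n by (cases n) auto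

lemma two_neq_0: "(2::'f) \<noteq> 0"
proof
  assume "(2::'f) = 0"
  moreover obtain m where "n = 2 * m + 1" using odd_n by (auto elim: oddE)
  ultimately have "of_nat n = (1::'f)" by simp
  then show False by (simp add: of_nat_n)
qed

lemma X_zero: "X \<zero> k = 0" and Y_zero: "Y \<zero> k = 0"
  using X_smult[of 0 \<zero> k] Y_smult[of 0 \<zero> k] smult_l_null[of \<zero>] by simp_all

lemma X_neg: "a \<in> carrier A \<Longrightarrow> X (\<ominus> a) k = - X a k" and Y_neg: "a \<in> carrier A \<Longrightarrow> Y (\<ominus> a) k = - Y a k"
  using X_add[of a "\<ominus> a" k] Y_add[of a "\<ominus> a" k]
  by (simp_all add: M.r_neg X_zero Y_zero eq_neg_iff_add_eq_0 add.commute)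

lemma X_diff: "b \<in> carrier A \<Longrightarrow> X (a \<ominus> b) k = X a k - X b k"
  and Y_diff: "b \<in> carrier A \<Longrightarrow> Y (a \<ominus> b) k = Y a k - Y b k"
  by (simp_all add: M.minus_eq X_add Y_add X_neg Y_neg)

lemma X_cong: "int n dvd k - l \<Longrightarrow> X a k = X a l" and Y_cong: "int n dvd k - l \<Longrightarrow> Y a k = Y a l"
  by (metis X_mod mod_eq_dvd_iff, metis Y_mod mod_eq_dvd_iff)

definition of_coords :: "(int \<Rightarrow> 'f) \<Rightarrow> (int \<Rightarrow> 'f) \<Rightarrow> 'a" where
  "of_coords x y = (SOME a. a \<in> carrier A \<and> X a = x \<and> Y a = y)"

lemma of_coords:
  assumes "\<And>k. x (k mod int n) = x k" "\<And>k. y (k mod int n) = y k"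
  shows of_coords_closed: "of_coords x y \<in> carrier A" and X_of_coords: "X (of_coords x y) = x" and Y_of_coords: "Y (of_coords x y) = y"
  using someI_ex[of "\<lambda>a. a \<in> carrier A \<and> X a = x \<and> Y a = y"] coords_exist[of x y] assms
  unfolding of_coords_def by blast+

definition rotation :: "int \<Rightarrow> 'a" where "rotation j = of_coords (\<lambda>k. of_bool (int n dvd k - j)) (\<lambda>k. 0)"
definition reflection :: "int \<Rightarrow> 'a" where "reflection j = of_coords (\<lambda>k. 0) (\<lambda>k. of_bool (int n dvd k - j))"

lemma dvd_mod_diff: "int n dvd k mod int n - j \<longleftrightarrow> int n dvd k - j"
  by (simp add: mod_eq_dvd_iff[symmetric])

lemma rotation_closed[simp]: "rotation j \<in> carrier A"
  and X_rot: "X (rotation j) k = of_bool (int n dvd k - j)" and Y_rot: "Y (rotation j) k = 0"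
  unfolding rotation_def by (simp_all add: of_coords dvd_mod_diff)

lemma reflection_closed[simp]: "reflection j \<in> carrier A"
  and X_refl: "X (reflection j) k = 0" and Y_refl: "Y (reflection j) k = of_bool (int n dvd k - j)"
  unfolding reflection_def by (simp_all add: of_coords dvd_mod_diff)

lemma basis_mult:
  assumes w: "w \<in> carrier A"
  shows "X (rotation j \<otimes> w) k = X w (k - j)" "Y (rotation j \<otimes> w) k = Y w (k - j)"
    "X (w \<otimes> rotation j) k = X w (k - j)" "Y (w \<otimes> rotation j) k = Y w (k + j)"
    "X (reflection j \<otimes> w) k = \<mu> * Y w (j - k)" "Y (reflection j \<otimes> w) k = X w (j - k)"
    "X (w \<otimes> reflection j) k = \<mu> * Y w (k + j)" "Y (w \<otimes> reflection j) k = X w (k - j)"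
proof -
  have per: "X a (k - i mod int n) = X a (k - i)" "X a (i mod int n - k) = X a (i - k)"
    "Y a (k - i mod int n) = Y a (k - i)" "Y a (i mod int n - k) = Y a (i - k)" for a i
    by (rule X_cong Y_cong, simp only: mod_eq_dvd_iff[symmetric] mod_simps)+
  have d: "int n dvd k - i - j \<longleftrightarrow> int n dvd i - (k - j)" "int n dvd i - k - j \<longleftrightarrow> int n dvd i - (k + j)" for i
    by (simp_all add: algebra_simps) (metis add.commute diff_diff_eq2 dvd_diff_commute)
  note sums = X_mult Y_mult X_rot Y_rot X_refl Y_refl w sum_distrib_left[symmetric]
    mult.commute[of _ "of_bool _"]
  note delta = sum_residues_delta[where n = n, OF n_pos]
  show "X (rotation j \<otimes> w) k = X w (k - j)" "Y (rotation j \<otimes> w) k = Y w (k - j)"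
    "Y (reflection j \<otimes> w) k = X w (j - k)"
    by (simp_all add: sums del: sum_of_bool_mult_eq sum_mult_of_bool_eq) (rule delta; simp add: per)+
  show "X (reflection j \<otimes> w) k = \<mu> * Y w (j - k)"
    by (simp add: sums del: sum_of_bool_mult_eq sum_mult_of_bool_eq) (rule disjI2, rule delta; simp add: per)
  show "X (w \<otimes> rotation j) k = X w (k - j)" "Y (w \<otimes> rotation j) k = Y w (k + j)"
    "Y (w \<otimes> reflection j) k = X w (k - j)"
    by (simp_all add: sums del: sum_of_bool_mult_eq sum_mult_of_bool_eq) (rule delta; simp add: X_mod Y_mod d)+
  show "X (w \<otimes> reflection j) k = \<mu> * Y w (k + j)"
    by (simp add: sums del: sum_of_bool_mult_eq sum_mult_of_bool_eq) (rule disjI2, rule delta; simp add: Y_mod d)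
qed

lemma one_eq_rotation: "\<one> = rotation 0"
  by (rule coords_eqI) (simp_all add: X_one Y_one X_rot Y_rot)

lemma basis_products:
  "rotation i \<otimes> rotation j = rotation (i + j)" "rotation i \<otimes> reflection j = reflection (i + j)"
  "reflection i \<otimes> rotation j = reflection (i - j)" "reflection i \<otimes> reflection j = \<mu> \<odot> rotation (i - j)"
  by (rule coords_eqI; simp add: basis_mult X_rot Y_rot X_refl Y_refl X_smult Y_smult algebra_simps)+

abbreviation "ders \<equiv> derivations (class_ring :: 'f ring) A"

lemma derivation_zero: "D \<in> ders \<Longrightarrow> D \<zero> = \<zero>"
  using derivation_smult[of D 0 \<zero>] derivation_closed[of D \<zero>] smult_l_null[of \<zero>] smult_l_null[of "D \<zero>"]
  by simp

lemma derivation_one: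
  assumes D: "D \<in> ders"
  shows "D \<one> = \<zero>"
proof -
  have "D \<one> = D \<one> \<oplus> D \<one>"
    using derivation_mult[OF D, of \<one> \<one>] derivation_closed[OF D] by simp
  then show ?thesis using derivation_closed[OF D, of \<one>] by (metis M.add.l_cancel_one' one_closed)
qed

text \<open>
  A derivation that kills \<open>u\<close> and \<open>v\<close> kills every \<open>u^i\<close> and \<open>u^i v\<close>. The passage to linear
  combinations is an induction on a bound for the support of the coordinates.
\<close>

lemma derivation_eq_zero:
  assumes D: "D \<in> ders" and D_rot: "D (rotation 1) = \<zero>" and D_refl: "D (reflection 0) = \<zero>" and a: "a \<in> carrier A"
  shows "D a = \<zero>"
proof -
  have rotation: "D (rotation (int k)) = \<zero>" for k
  proof (induction k)
    case 0
    show ?case using derivation_one[OF D] by (simp add: one_eq_rotation)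
  next
    case (Suc k)
    have "rotation (int (Suc k)) = rotation (int k) \<otimes> rotation 1" by (simp add: basis_products add.commute)
    then show ?case using derivation_mult[OF D, of "rotation (int k)" "rotation 1"] by (simp add: Suc D_rot)
  qed
  have reflection: "D (reflection (int k)) = \<zero>" for k
  proof -
    have "reflection (int k) = rotation (int k) \<otimes> reflection 0" by (simp add: basis_products)
    then show ?thesis using derivation_mult[OF D, of "rotation (int k)" "reflection 0"] by (simp add: rotation D_refl)
  qed
  \<comment> \<open>Only coordinates at residues below \<open>m\<close> may be nonzero; splitting off the two at \<open>m\<close> is
    the induction step.\<close>
  have "D a = \<zero>"
    if "a \<in> carrier A" "m \<le> n" "\<And>k. int m \<le> k mod int n \<Longrightarrow> X a k = 0 \<and> Y a k = 0" for m a
    using that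
  proof (induction m arbitrary: a)
    case 0
    then have "a = \<zero>" using n_pos by (intro coords_eqI) (auto simp: X_zero Y_zero)
    then show ?case using derivation_zero[OF D] by simp
  next
    case (Suc m)
    define x where "x k = (if k mod int n = int m then 0 else X a k)" for k
    define y where "y k = (if k mod int n = int m then 0 else Y a k)" for k
    define b where "b = of_coords x y"
    have b: "b \<in> carrier A" "X b = x" "Y b = y"
      unfolding b_def by (intro of_coords; simp add: x_def y_def X_mod Y_mod)+
    have dvd: "int n dvd k - int m \<longleftrightarrow> k mod int n = int m" for k
      using Suc.prems(2) by (simp add: mod_eq_dvd_iff[symmetric])
    have at_m: "X a k = X a (int m)" "Y a k = Y a (int m)" if "k mod int n = int m" for k
      using that X_mod[of a k] Y_mod[of a k] by simp_all
    have a: "a = b \<oplus> (X a (int m) \<odot> rotation (int m) \<oplus> Y a (int m) \<odot> reflection (int m))"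
      using b Suc.prems(1)
      by (intro coords_eqI)
         (auto simp: X_add Y_add X_smult Y_smult X_rot Y_rot X_refl Y_refl dvd x_def y_def at_m)
    have "D b = \<zero>"
    proof (rule Suc.IH)
      fix k assume "int m \<le> k mod int n"
      then show "X b k = 0 \<and> Y b k = 0"
        using Suc.prems(3)[of k] by (auto simp: b x_def y_def)
    qed (use b Suc.prems in auto)
    then show ?case
      using b(1) by (subst a) (simp add: derivation_add[OF D] derivation_smult[OF D] rotation reflection smult_r_null)
  qed
  moreover have "\<not> int n \<le> k mod int n" for k using n_pos by (simp add: not_le)
  ultimately show ?thesis using a by blast
qed

text \<open>
  Let \<open>w = D u\<close>. Applying \<open>D\<close> to \<open>v u = u^(-1) v\<close> gives \<open>v w = - u^(-1) w u^(-1) v\<close>; multiplied by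
  \<open>u\<close> from the left this is \<open>u v w + w v u = 0\<close>, and comparing coefficients yields both
  symmetries.
\<close>

lemma derivation_killing_reflection:
  assumes D: "D \<in> ders" and D_refl: "D (reflection 0) = \<zero>"
  shows "X (D (rotation 1)) (1 - k) = - X (D (rotation 1)) (1 + k)" "Y (D (rotation 1)) (- k) = - Y (D (rotation 1)) k"
proof -
  define w where "w = D (rotation 1)"
  define w' where "w' = D (rotation (- 1))"
  have w: "w \<in> carrier A" and w': "w' \<in> carrier A" using derivation_closed[OF D] by (simp_all add: w_def w'_def)
  have "D (rotation 1 \<otimes> rotation (- 1)) = \<zero>"
    using derivation_one[OF D] by (simp add: basis_products one_eq_rotation)
  then have 1: "w \<otimes> rotation (- 1) \<oplus> rotation 1 \<otimes> w' = \<zero>"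
    by (simp add: derivation_mult[OF D] w_def w'_def)
  have "D (reflection 0 \<otimes> rotation 1) = D (rotation (- 1) \<otimes> reflection 0)" by (simp add: basis_products)
  then have 2: "reflection 0 \<otimes> w = w' \<otimes> reflection 0"
    using w w' by (simp only: derivation_mult[OF D] rotation_closed reflection_closed D_refl w_def w'_def) simp
  have "rotation 1 \<otimes> reflection 0 \<otimes> w = rotation 1 \<otimes> w' \<otimes> reflection 0" using w w' 2 by (simp add: m_assoc)
  then have "reflection 1 \<otimes> w \<oplus> w \<otimes> reflection (- 1) = (w \<otimes> rotation (- 1) \<oplus> rotation 1 \<otimes> w') \<otimes> reflection 0"
    using w w' by (simp add: l_distr m_assoc M.a_comm basis_products)
  then have eq: "reflection 1 \<otimes> w \<oplus> w \<otimes> reflection (- 1) = \<zero>" by (simp add: 1)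
  have "Y w (1 + j) + Y w (- j - 1) = 0" for j
    using arg_cong[OF eq, of "\<lambda>a. X a (- j)"] w \<mu>
    by (simp add: X_add X_zero basis_mult distrib_left[symmetric])
  from this[of "k - 1"] show "Y (D (rotation 1)) (- k) = - Y (D (rotation 1)) k"
    by (simp add: w_def eq_neg_iff_add_eq_0 add.commute)
  have "X w (1 - k) + X w (1 + k) = 0"
    using arg_cong[OF eq, of "\<lambda>a. Y a k"] w by (simp add: Y_add Y_zero basis_mult add.commute)
  then show "X (D (rotation 1)) (1 - k) = - X (D (rotation 1)) (1 + k)"
    by (simp add: w_def eq_neg_iff_add_eq_0)
qed

text \<open>
  Since \<open>v^2\<close> is a scalar, \<open>q = D v\<close> anticommutes with \<open>v\<close>. Therefore \<open>q v / (2 \<mu>)\<close> has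
  commutator \<open>q\<close> with \<open>v\<close>; this is where the characteristic has to be odd.
\<close>

lemma exists_ad_on_reflection:
  assumes D: "D \<in> ders"
  obtains a where "a \<in> carrier A" "ad a (reflection 0) = D (reflection 0)"
proof -
  define q where "q = D (reflection 0)"
  have q: "q \<in> carrier A" using derivation_closed[OF D] by (simp add: q_def)
  have "D (reflection 0 \<otimes> reflection 0) = \<zero>"
    using derivation_one[OF D] by (simp add: basis_products derivation_smult[OF D] one_eq_rotation smult_r_null)
  then have anti: "q \<otimes> reflection 0 \<oplus> reflection 0 \<otimes> q = \<zero>" by (simp add: derivation_mult[OF D] q_def)
  have anti_X: "\<mu> * Y q k + \<mu> * Y q (- k) = 0" and anti_Y: "X q k + X q (- k) = 0" for k
    using arg_cong[OF anti, of "\<lambda>a. X a k"] arg_cong[OF anti, of "\<lambda>a. Y a k"] q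
    by (simp_all add: X_add Y_add X_zero Y_zero basis_mult)
  have anti_X': "Y q (- k) = - Y q k" and anti_Y': "X q (- k) = - X q k" for k
    using anti_X[of k] anti_Y[of k] \<mu> by (simp_all add: distrib_left[symmetric] eq_neg_iff_add_eq_0 add.commute)
  define a where "a = inverse (2 * \<mu>) \<odot> (q \<otimes> reflection 0)"
  have a: "a \<in> carrier A" using q by (simp add: a_def)
  have "a \<otimes> reflection 0 \<ominus> reflection 0 \<otimes> a = q"
  proof (rule coords_eqI)
    show "X (a \<otimes> reflection 0 \<ominus> reflection 0 \<otimes> a) k = X q k" for k
      using a q \<mu> two_neq_0
      by (simp add: X_diff basis_mult) (simp add: a_def X_smult Y_smult basis_mult anti_X' anti_Y' field_simps)
    show "Y (a \<otimes> reflection 0 \<ominus> reflection 0 \<otimes> a) k = Y q k" for k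
      using a q \<mu> two_neq_0
      by (simp add: Y_diff basis_mult) (simp add: a_def X_smult Y_smult basis_mult anti_X' anti_Y' field_simps)
  qed (use a q in simp_all)
  then show ?thesis using a by (intro that[of a]) (simp_all add: ad_def q_def)
qed

text \<open>
  The coefficients of \<open>u^2, \<dots>, u^(m+1)\<close> in \<open>D u\<close>, where \<open>n = 2 m + 1\<close>. Equivalently, these are
  the coefficients of \<open>u, \<dots>, u^m\<close> in \<open>u^(-1) D u\<close>, whose rotation part is antisymmetric once
  \<open>D v = 0\<close> and thus determined by them.
\<close>

definition coefficient_map :: "('a \<Rightarrow> 'a) \<Rightarrow> 'f vec" where
  "coefficient_map D = vec ((n - 1) div 2) (\<lambda>j. X (D (rotation 1)) (int j + 2))"

text \<open>
  Left and right multiplication by \<open>u\<close> agree on rotations, and commutators of reflections with \<open>u\<close>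
  are combinations of reflections. So inner derivations do not affect the rotation part of \<open>D u\<close>.
\<close>

lemma X_ad_rotation: "a \<in> carrier A \<Longrightarrow> X (ad a (rotation 1)) k = 0"
  by (simp add: ad_def X_diff basis_mult)

lemma coefficient_map_ad: "a \<in> carrier A \<Longrightarrow> coefficient_map (ad a) = 0\<^sub>v ((n - 1) div 2)"
  by (auto simp: coefficient_map_def X_ad_rotation intro!: eq_vecI)

lemma derivation_sub_ad:
  assumes D: "D \<in> ders" and a: "a \<in> carrier A"
  shows "restrict (\<lambda>x. D x \<ominus> ad a x) (carrier A) \<in> ders"
proof -
  have ad: "ad a \<in> ders" using a by (rule ad_derivation)
  show ?thesis
    by (intro derivationsI)
       (simp_all add: derivationsD[OF D] derivationsD[OF ad] M.minus_eq smult_r_distr smult_r_minus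
          l_distr r_distr l_minus r_minus M.minus_add M.a_ac)
qed

text \<open>
  Subtracting an inner derivation makes \<open>D v = 0\<close> without changing the rotation part of \<open>D u\<close>, which
  then vanishes by antisymmetry. What remains, \<open>D u = \<Sum> y k u^k v\<close> with \<open>y\<close> odd, is the commutator
  of \<open>\<Sum> \<epsilon> k u^k v\<close> with \<open>u\<close> when \<open>\<epsilon> (k + 1) - \<epsilon> (k - 1) = y k\<close>, and this element commutes
  with \<open>v\<close> when \<open>\<epsilon>\<close> is even.
\<close>

lemma coefficient_map_kernel:
  assumes D: "D \<in> ders" and zero: "coefficient_map D = 0\<^sub>v ((n - 1) div 2)"
  shows "D \<in> ad ` carrier A"
proof -
  obtain a where a: "a \<in> carrier A" and ad_a: "ad a (reflection 0) = D (reflection 0)"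
    by (rule exists_ad_on_reflection[OF D])
  define D1 where "D1 = restrict (\<lambda>x. D x \<ominus> ad a x) (carrier A)"
  have D1: "D1 \<in> ders" unfolding D1_def by (rule derivation_sub_ad[OF D a])
  have D1_refl: "D1 (reflection 0) = \<zero>"
    using derivation_closed[OF D] by (simp add: D1_def ad_a M.r_neg M.minus_eq)
  note sym = derivation_killing_reflection[OF D1 D1_refl]
  define w where "w = D1 (rotation 1)"
  have w: "w \<in> carrier A" using derivation_closed[OF D1] by (simp add: w_def)
  have X_w: "X w k = X (D (rotation 1)) k" for k
    using derivation_closed[OF ad_derivation[OF a]] X_ad_rotation[OF a] by (simp add: w_def D1_def X_diff)
  obtain m where m: "n = 2 * m + 1" using odd_n by (auto elim: oddE)
  have m': "(n - Suc 0) div 2 = m" by (simp add: m)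
  have low: "X w (1 + int k) = 0" if "1 \<le> k" "k \<le> m" for k
  proof -
    have "coefficient_map D $ (k - 1) = 0" using that by (simp add: zero m')
    then show ?thesis using that by (simp add: coefficient_map_def m' X_w of_nat_diff add.commute)
  qed
  have X_w_zero: "X w k = 0" for k
  proof -
    define l where "l = nat ((k - 1) mod int n)"
    have l: "int l = (k - 1) mod int n" "l < n" using n_pos by (simp_all add: l_def nat_less_iff)
    have k: "X w k = X w (1 + int l)"
      by (rule X_cong) (simp add: l mod_eq_dvd_iff[symmetric] mod_simps)
    consider "l = 0" | "1 \<le> l" "l \<le> m" | "m < l" by linarith
    then have "X w (1 + int l) = 0"
    proof cases
      case 1
      have "2 * X w 1 = 0" using sym(1)[of 0] by (simp add: w_def)
      then show ?thesis using two_neq_0 1 by simp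
    next
      case 2
      then show ?thesis by (rule low)
    next
      case 3
      have "X w (1 + int l) = X w (1 - int (n - l))"
        using l by (intro X_cong) (simp add: of_nat_diff)
      also have "\<dots> = - X w (1 + int (n - l))" using sym(1)[of "int (n - l)"] by (simp add: w_def)
      also have "\<dots> = 0" using low[of "n - l"] 3 l m by simp
      finally show ?thesis .
    qed
    then show ?thesis by (simp add: k)
  qed
  obtain \<epsilon> where \<epsilon>: "\<And>k. \<epsilon> (k mod int n) = \<epsilon> k" "\<And>k. \<epsilon> (- k) = \<epsilon> k"
      "\<And>k. \<epsilon> (k + 1) - \<epsilon> (k - 1) = Y w k"
    using symmetric_primitive_mod_odd[OF odd_n two_neq_0, where y = "Y w", OF Y_mod sym(2)[folded w_def]]
    by blast
  define b where "b = of_coords (\<lambda>_. 0) \<epsilon>"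
  have b: "b \<in> carrier A" "X b = (\<lambda>_. 0)" "Y b = \<epsilon>"
    unfolding b_def by (intro of_coords; simp add: \<epsilon>(1))+
  have "ad b (rotation 1) = w"
    using b w \<epsilon>(3) by (intro coords_eqI) (auto simp: ad_def X_diff Y_diff basis_mult X_w_zero)
  moreover have "ad b (reflection 0) = \<zero>"
    using b by (intro coords_eqI) (auto simp: ad_def X_diff Y_diff X_zero Y_zero basis_mult \<epsilon>(2))
  moreover define D2 where "D2 = restrict (\<lambda>x. D1 x \<ominus> ad b x) (carrier A)"
  ultimately have "D2 (rotation 1) = \<zero>" "D2 (reflection 0) = \<zero>"
    using w by (simp_all add: D1_refl w_def M.r_neg M.minus_eq)
  moreover have "D2 \<in> ders" unfolding D2_def by (rule derivation_sub_ad[OF D1 b(1)])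
  ultimately have D2_zero: "D2 x = \<zero>" if "x \<in> carrier A" for x
    using derivation_eq_zero that by blast
  have "D = ad (a \<oplus> b)"
  proof (rule derivation_eqI[OF D])
    show "ad (a \<oplus> b) \<in> ders" using a b by (intro ad_derivation) simp
    fix x assume x: "x \<in> carrier A"
    have Dx: "D x \<in> carrier A" "ad a x \<in> carrier A" "ad b x \<in> carrier A"
      using x derivation_closed D ad_derivation a b(1) by blast+
    have eq: "D x \<ominus> ad a x \<ominus> ad b x = \<zero>" using D2_zero[OF x] x by (simp add: D2_def D1_def)
    have "D x = ad a x \<oplus> ad b x"
      using arg_cong[OF eq, of X] arg_cong[OF eq, of Y] Dx
      by (intro coords_eqI) (auto simp: fun_eq_iff X_add Y_add X_diff Y_diff X_zero Y_zero algebra_simps)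
    also have "\<dots> = ad (a \<oplus> b) x"
      using a b(1) x by (intro coords_eqI)
        (auto simp: ad_def l_distr r_distr X_add Y_add X_diff Y_diff)
    finally show "D x = ad (a \<oplus> b) x" .
  qed
  then show ?thesis using a b by blast
qed

text \<open>
  Let \<open>\<xi> = \<Sum> x k u^k\<close>. As \<open>n = 0\<close> in the field, the degree operator \<open>E\<close>, which multiplies \<open>u^i\<close>
  and \<open>u^i v\<close> by \<open>i\<close>, is well defined. The degree is a crossed homomorphism, so \<open>E\<close> is a derivation
  up to the automorphism \<open>bar\<close> that negates the reflections: \<open>E (a b) = E a b + bar a E b\<close>.
  Antisymmetry of \<open>x\<close> means that \<open>v\<close> anticommutes with \<open>\<xi>\<close>, i.e. \<open>a \<xi> = \<xi> bar a\<close> for all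
  \<open>a\<close>. The two twists cancel in \<open>a \<mapsto> \<xi> E a\<close>, which is a true derivation; it maps \<open>u\<close> to
  \<open>\<xi> u\<close>.
\<close>

lemma antisymmetric_derivation:
  assumes x: "\<And>k. x (k mod int n) = x k" and anti: "\<And>k. x (- k) = - x k"
  obtains D where "D \<in> ders" "\<And>k. X (D (rotation 1)) (k + 1) = x k"
proof -
  have n0: "of_int (int n) = (0::'f)" by (simp add: of_nat_n)
  have of_int_mod: "of_int (k mod int n) = (of_int k :: 'f)" for k
    by (metis mod_mult_div_eq[of k "int n"] of_int_add of_int_mult n0 mult_zero_left add_0_right)
  define \<xi> where "\<xi> = of_coords x (\<lambda>_. 0)"
  have \<xi>: "\<xi> \<in> carrier A" "X \<xi> = x" "Y \<xi> = (\<lambda>_. 0)"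
    unfolding \<xi>_def by (intro of_coords; simp add: x)+
  define E where "E a = of_coords (\<lambda>k. of_int k * X a k) (\<lambda>k. of_int k * Y a k)" for a
  have E: "E a \<in> carrier A" "X (E a) = (\<lambda>k. of_int k * X a k)" "Y (E a) = (\<lambda>k. of_int k * Y a k)" for a
    unfolding E_def by (intro of_coords; simp add: X_mod Y_mod of_int_mod)+
  define bar where "bar a = of_coords (X a) (\<lambda>k. - Y a k)" for a
  have bar: "bar a \<in> carrier A" "X (bar a) = X a" "Y (bar a) = (\<lambda>k. - Y a k)" for a
    unfolding bar_def by (intro of_coords; simp add: X_mod Y_mod)+
  have E_mult: "E (a \<otimes> b) = E a \<otimes> b \<oplus> bar a \<otimes> E b" if a: "a \<in> carrier A" and b: "b \<in> carrier A" for a b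
  proof (rule coords_eqI)
    fix k
    have "X (E (a \<otimes> b)) k = (\<Sum>i\<in>{0..<int n}.
        of_int k * (X a i * X b (k - i) + \<mu> * (Y a i * Y b (i - k))))"
      by (simp only: E X_mult[OF a b] sum_distrib_left)
    also have "\<dots> = (\<Sum>i\<in>{0..<int n}.
        ((of_int i * X a i) * X b (k - i) + \<mu> * ((of_int i * Y a i) * Y b (i - k))) +
        (X a i * (of_int (k - i) * X b (k - i)) + \<mu> * (- Y a i * (of_int (i - k) * Y b (i - k)))))"
      by (rule sum.cong) (simp_all add: algebra_simps)
    also have "\<dots> = X (E a \<otimes> b \<oplus> bar a \<otimes> E b) k"
      using a b E(1) bar(1) by (simp only: X_add X_mult E(2,3) bar(2,3) sum.distrib)
    finally show "X (E (a \<otimes> b)) k = X (E a \<otimes> b \<oplus> bar a \<otimes> E b) k" .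
    have "Y (E (a \<otimes> b)) k = (\<Sum>i\<in>{0..<int n}.
        of_int k * (X a i * Y b (k - i) + Y a i * X b (i - k)))"
      by (simp only: E Y_mult[OF a b] sum_distrib_left)
    also have "\<dots> = (\<Sum>i\<in>{0..<int n}.
        ((of_int i * X a i) * Y b (k - i) + (of_int i * Y a i) * X b (i - k)) +
        (X a i * (of_int (k - i) * Y b (k - i)) + - Y a i * (of_int (i - k) * X b (i - k))))"
      by (rule sum.cong) (simp_all add: algebra_simps)
    also have "\<dots> = Y (E a \<otimes> b \<oplus> bar a \<otimes> E b) k"
      using a b E(1) bar(1) by (simp only: Y_add Y_mult E(2,3) bar(2,3) sum.distrib)
    finally show "Y (E (a \<otimes> b)) k = Y (E a \<otimes> b \<oplus> bar a \<otimes> E b) k" .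
  qed (use a b E(1) bar(1) in simp_all)
  have x_mod: "x (k - i mod int n) = x (k - i)" "x (i mod int n - k) = x (i - k)" for i k
    by (rule trans[OF x[symmetric]], simp only: mod_simps, rule x)+
  have \<xi>_comm: "a \<otimes> \<xi> = \<xi> \<otimes> bar a" if a: "a \<in> carrier A" for a
  proof (rule coords_eqI)
    fix k
    have "X (a \<otimes> \<xi>) k = (\<Sum>i\<in>{0..<int n}. X a i * x (k - i))"
      using a \<xi> by (simp add: X_mult)
    also have "\<dots> = (\<Sum>i\<in>{0..<int n}. X a (k - i) * x i)"
      using sum_residues_reflect[OF n_pos, of "\<lambda>i. X a i * x (k - i)" k] X_mod x_mod
      by simp
    also have "\<dots> = X (\<xi> \<otimes> bar a) k"
      using a \<xi>(1) bar(1) by (simp add: X_mult \<xi>(2,3) bar(2,3) mult.commute)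
    finally show "X (a \<otimes> \<xi>) k = X (\<xi> \<otimes> bar a) k" .
    have "Y (a \<otimes> \<xi>) k = (\<Sum>i\<in>{0..<int n}. Y a i * x (i - k))"
      using a \<xi> by (simp add: Y_mult)
    also have "\<dots> = (\<Sum>i\<in>{0..<int n}. Y a (k - i) * x (- i))"
      using sum_residues_reflect[OF n_pos, of "\<lambda>i. Y a i * x (i - k)" k] Y_mod x_mod
      by simp
    also have "\<dots> = Y (\<xi> \<otimes> bar a) k"
      using a \<xi>(1) bar(1) by (simp add: Y_mult \<xi>(2,3) bar(2,3) anti mult.commute)
    finally show "Y (a \<otimes> \<xi>) k = Y (\<xi> \<otimes> bar a) k" .
  qed (use a \<xi> bar in auto)
  define D where "D = restrict (\<lambda>a. \<xi> \<otimes> E a) (carrier A)"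
  have "D \<in> ders" unfolding D_def
  proof (rule derivationsI)
    fix a b assume a: "a \<in> carrier A" and b: "b \<in> carrier A"
    have "E (a \<oplus> b) = E a \<oplus> E b"
      using a b E(1) by (intro coords_eqI) (simp_all add: E(2,3) X_add Y_add algebra_simps)
    then show "\<xi> \<otimes> E (a \<oplus> b) = \<xi> \<otimes> E a \<oplus> \<xi> \<otimes> E b" using \<xi> E(1) by (simp add: r_distr)
    have "\<xi> \<otimes> (bar a \<otimes> E b) = a \<otimes> (\<xi> \<otimes> E b)"
      using a \<xi>(1) E(1) bar(1) \<xi>_comm[OF a] by (simp add: m_assoc[symmetric])
    then show "\<xi> \<otimes> E (a \<otimes> b) = \<xi> \<otimes> E a \<otimes> b \<oplus> a \<otimes> (\<xi> \<otimes> E b)"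
      using a b \<xi>(1) E(1) bar(1) by (simp add: E_mult r_distr m_assoc)
  next
    fix c :: 'f and a assume a: "a \<in> carrier A"
    have "E (c \<odot> a) = c \<odot> E a"
      using a E(1) by (intro coords_eqI) (simp_all add: E(2,3) X_smult Y_smult mult_ac)
    then show "\<xi> \<otimes> E (c \<odot> a) = c \<odot> (\<xi> \<otimes> E a)" using \<xi>(1) E(1) by (simp add: smult_mult_right)
  qed (use \<xi>(1) E(1) in simp)
  moreover have "X (D (rotation 1)) (k + 1) = x k" for k
  proof -
    have "of_int j * of_bool (int n dvd j - 1) = (of_bool (int n dvd j - 1) :: 'f)" for j
    proof (cases "int n dvd j - 1")
      case True
      then have "j mod int n = 1 mod int n" by (simp add: mod_eq_dvd_iff)
      then have "(of_int j :: 'f) = 1" using of_int_mod[of j] of_int_mod[of 1] by simp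
      then show ?thesis by simp
    qed simp
    then have "E (rotation 1) = rotation 1"
      using E(1) by (intro coords_eqI) (simp_all add: E(2,3) X_rot Y_rot)
    then show ?thesis using \<xi> by (simp add: D_def basis_mult)
  qed
  ultimately show ?thesis by (rule that)
qed

lemma coefficient_map_surj:
  assumes w: "w \<in> carrier_vec ((n - 1) div 2)"
  obtains D where "D \<in> ders" "coefficient_map D = w"
proof -
  obtain m where m: "n = 2 * m + 1" using odd_n by (auto elim: oddE)
  have m': "(n - Suc 0) div 2 = m" by (simp add: m)
  define x where "x k = (let j = k mod int n in
      if j = 0 then 0 else if j \<le> int m then w $ nat (j - 1) else - w $ nat (int n - j - 1))" for k
  have "x (k mod int n) = x k" for k by (simp add: x_def)
  moreover have "x (- k) = - x k" for k
  proof -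
    define j where "j = k mod int n"
    have j: "0 \<le> j" "j < int n" using n_pos by (simp_all add: j_def)
    show ?thesis
    proof (cases "j = 0")
      case False
      then have "(- k) mod int n = int n - j" by (simp add: j_def zmod_zminus1_eq_if)
      then have "x (- k) = (if int n - j \<le> int m then w $ nat (int n - j - 1) else - w $ nat (j - 1))"
        using j by (simp add: x_def Let_def)
      moreover have "x k = (if j \<le> int m then w $ nat (j - 1) else - w $ nat (int n - j - 1))"
        using False by (simp add: x_def j_def)
      ultimately show ?thesis using m by auto
    next
      case True
      then have "(- k) mod int n = 0" by (simp add: j_def zmod_zminus1_eq_if)
      then show ?thesis using True by (simp add: x_def j_def[symmetric] Let_def)
    qed
  qed
  ultimately obtain D where D: "D \<in> ders" "\<And>k. X (D (rotation 1)) (k + 1) = x k"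
    using antisymmetric_derivation[of x] by blast
  have "coefficient_map D = w"
  proof (rule eq_vecI)
    show "dim_vec (coefficient_map D) = dim_vec w" using w by (simp add: coefficient_map_def)
    fix j assume "j < dim_vec w"
    then have j: "j < m" using w m' by simp
    have "coefficient_map D $ j = x (int j + 1)"
      using j m' D(2)[of "int j + 1"] by (simp add: coefficient_map_def add.assoc)
    also have "\<dots> = w $ j" using j m by (simp add: x_def Let_def)
    finally show "coefficient_map D $ j = w $ j" .
  qed
  with D show ?thesis by (intro that)
qed

lemma HH1_dihedral_algebra:
  "isomorphic_vector_spaces (class_ring :: 'f ring) (HH1 class_ring A) (module_vec TYPE('f) ((n - 1) div 2))"
  unfolding HH1_def
proof (rule quotient_by_kernel_isomorphic)
  show "field (class_ring :: 'f ring)" by (rule class_field)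
  show "Module.module (class_ring :: 'f ring) (derivation_module class_ring A)"
    by (rule derivation_module_module)
  show "Module.module (class_ring :: 'f ring) (module_vec TYPE('f) ((n - 1) div 2))"
    by (rule vec_module)
  show "coefficient_map \<in> LinearCombinations.module_hom class_ring (derivation_module class_ring A)
          (module_vec TYPE('f) ((n - 1) div 2))"
    by (auto simp: LinearCombinations.module_hom_def module_vec_simps DM_simps coefficient_map_def
          X_add X_smult intro!: eq_vecI)
  show "coefficient_map ` carrier (derivation_module class_ring A) =
          carrier (module_vec TYPE('f) ((n - 1) div 2))"
  proof
    show "coefficient_map ` carrier (derivation_module class_ring A) \<subseteq>
          carrier (module_vec TYPE('f) ((n - 1) div 2))"
      by (auto simp: module_vec_simps coefficient_map_def)
    show "carrier (module_vec TYPE('f) ((n - 1) div 2)) \<subseteq>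
          coefficient_map ` carrier (derivation_module class_ring A)"
    proof
      fix w assume "w \<in> carrier (module_vec TYPE('f) ((n - 1) div 2))"
      then have "w \<in> carrier_vec ((n - 1) div 2)" by (simp only: module_vec_simps)
      then obtain D where "D \<in> ders" "coefficient_map D = w" by (rule coefficient_map_surj)
      then show "w \<in> coefficient_map ` carrier (derivation_module class_ring A)"
        by (auto simp: DM_simps)
    qed
  qed
  show "inner_derivations A = {D \<in> carrier (derivation_module class_ring A).
          coefficient_map D = \<zero>\<^bsub>module_vec TYPE('f) ((n - 1) div 2)\<^esub>}"
    using coefficient_map_kernel coefficient_map_ad ad_derivation
    by (auto simp: inner_derivations_eq module_vec_simps DM_simps)
qed

end

section \<open>Coordinates on the twisted group ring\<close>

context dihedral begin

lemma lookup_twisted_mult: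
  assumes "u \<in> carrier (twisted_group_ring G \<alpha>)" "v \<in> carrier (twisted_group_ring G \<alpha>)"
    and k: "k \<in> carrier G"
  shows "Poly_Mapping.lookup (u \<otimes>\<^bsub>twisted_group_ring G \<alpha>\<^esub> v) k =
    (\<Sum>g\<in>carrier G. Poly_Mapping.lookup u g * Poly_Mapping.lookup v (inv g \<otimes> k) * \<alpha> g (inv g \<otimes> k))"
proof -
  have "Poly_Mapping.lookup (u \<otimes>\<^bsub>twisted_group_ring G \<alpha>\<^esub> v) k =
    (\<Sum>g\<in>carrier G. \<Sum>h\<in>carrier G.
       if h = inv g \<otimes> k then Poly_Mapping.lookup u g * Poly_Mapping.lookup v h * \<alpha> g h else 0)"
    using assms finite_carrier
    by (subst twisted_mult_superset[of "carrier G" _ "carrier G"])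
       (auto simp: twisted_group_ring_simps lookup_sum lookup_single when_def inv_solve_left
          intro!: sum.cong)
  also have "\<dots> = (\<Sum>g\<in>carrier G. Poly_Mapping.lookup u g * Poly_Mapping.lookup v (inv g \<otimes> k) * \<alpha> g (inv g \<otimes> k))"
    using k finite_carrier by (intro sum.cong) (auto simp: sum.delta)
  finally show ?thesis .
qed

lemma inv_R: "inv (R i) = R (- i)"
  by (rule inv_equality) (simp_all add: RR R_0 R_closed)

lemma inv_S: "inv (S i) = S i"
  by (rule inv_equality) (simp_all add: SS R_0 S_closed)

lemma twisted_group_ring_dihedral_algebra:
  fixes \<alpha> :: "'g \<Rightarrow> 'g \<Rightarrow> 'f::field"
  assumes n: "odd n" and char: "of_nat n = (0::'f)" and \<alpha>: "normalized_cocycle G \<alpha>"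
  obtains \<mu> X Y where "dihedral_algebra (twisted_group_ring G \<alpha>) n \<mu> X Y"
proof -
  let ?A = "twisted_group_ring G \<alpha>"
  interpret A: assoc_algebra "class_ring :: 'f ring" ?A
    by (rule twisted_group_ring_assoc_algebra) (use \<alpha> is_group in auto)
  interpret A: field_algebra ?A ..
  obtain \<mu> and c t :: "int \<Rightarrow> 'f" where \<mu>: "\<mu> \<noteq> 0" and nz: "\<And>i. c i \<noteq> 0" "\<And>i. t i \<noteq> 0" and c0: "c 0 = 1"
    and mods: "\<And>i. c (i mod int n) = c i" "\<And>i. t (i mod int n) = t i"
    and cc: "\<And>i j. c i * c j * \<alpha> (R i) (R j) = c (i + j)" and ct: "\<And>i j. c i * t j * \<alpha> (R i) (S j) = t (i + j)"
    and tc: "\<And>i j. t i * c j * \<alpha> (S i) (R j) = t (i - j)" and tt: "\<And>i j. t i * t j * \<alpha> (S i) (S j) = \<mu> * c (i - j)"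
    using cocycle_normal_form[OF n \<alpha>] by blast
  define X where "X u i = Poly_Mapping.lookup u (R i) / c i" for u i
  define Y where "Y u i = Poly_Mapping.lookup u (S i) / t i" for u i
  have lookup_R: "Poly_Mapping.lookup u (R i) = c i * X u i" for u i by (simp add: X_def nz)
  have lookup_S: "Poly_Mapping.lookup u (S i) = t i * Y u i" for u i by (simp add: Y_def nz)
  have "dihedral_algebra ?A n \<mu> X Y"
  proof unfold_locales
    show "X a (k mod int n) = X a k" "Y a (k mod int n) = Y a k" for a k
      by (simp_all add: X_def Y_def mods R_mod S_mod)
    show "X (a \<oplus>\<^bsub>?A\<^esub> b) k = X a k + X b k" "Y (a \<oplus>\<^bsub>?A\<^esub> b) k = Y a k + Y b k" for a b k
      by (simp_all add: X_def Y_def twisted_group_ring_simps lookup_add add_divide_distrib)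
    show "X (x \<odot>\<^bsub>?A\<^esub> a) k = x * X a k" "Y (x \<odot>\<^bsub>?A\<^esub> a) k = x * Y a k" for x a k
      by (simp_all add: X_def Y_def lookup_twisted_smult)
    show "X \<one>\<^bsub>?A\<^esub> k = of_bool (int n dvd k)" for k
    proof (cases "int n dvd k")
      case True
      then have "R k = \<one>" "c k = 1" using mods(1)[of k] c0 R_mod[of k] by (simp_all add: R_0)
      then show ?thesis using True by (simp add: X_def twisted_group_ring_simps)
    next
      case False
      then have "R 0 \<noteq> R k" by (simp add: R_eq_iff)
      then show ?thesis using False by (simp add: X_def twisted_group_ring_simps R_0 lookup_single)
    qed
    show "Y \<one>\<^bsub>?A\<^esub> k = 0" for k
      using R_neq_S[of 0 k] by (simp add: Y_def twisted_group_ring_simps R_0 lookup_single)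
    show "a = b" if "a \<in> carrier ?A" "b \<in> carrier ?A" "\<And>k. X a k = X b k" "\<And>k. Y a k = Y b k" for a b
    proof (rule poly_mapping_eqI)
      fix g
      show "Poly_Mapping.lookup a g = Poly_Mapping.lookup b g"
      proof (cases "g \<in> carrier G")
        case True
        then show ?thesis using that(3,4) by (auto simp: carrier_eq lookup_R lookup_S)
      next
        case False
        then have "Poly_Mapping.lookup a g = 0" "Poly_Mapping.lookup b g = 0"
          using that(1,2) by (auto simp: twisted_group_ring_simps in_keys_iff)
        then show ?thesis by simp
      qed
    qed
    show "\<exists>a \<in> carrier ?A. X a = x \<and> Y a = y"
      if x: "\<And>k. x (k mod int n) = x k" and y: "\<And>k. y (k mod int n) = y k" for x y
    proof -
      define a where "a = (\<Sum>i\<in>{0..<int n}. Poly_Mapping.single (R i) (c i * x i)) +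
          (\<Sum>i\<in>{0..<int n}. Poly_Mapping.single (S i) (t i * y i))"
      have R_at: "Poly_Mapping.lookup (Poly_Mapping.single (R i) z) (R k) = of_bool (int n dvd i - k) * z" for i k and z :: 'f
        by (simp add: lookup_single when_def R_eq_iff)
      have S_at: "Poly_Mapping.lookup (Poly_Mapping.single (S i) z) (S k) = of_bool (int n dvd i - k) * z" for i k and z :: 'f
        by (simp add: lookup_single when_def S_eq_iff)
      have RS_at: "Poly_Mapping.lookup (Poly_Mapping.single (R i) z) (S k) = 0"
        "Poly_Mapping.lookup (Poly_Mapping.single (S i) z) (R k) = 0" for i k and z :: 'f
        using R_neq_S by (simp_all add: lookup_single when_def) metis+
      have "X a k = x k" for k
        using sum_residues_delta[OF n_pos, of "\<lambda>i. c i * x i" "\<lambda>i. int n dvd i - k" k] nz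
        by (simp add: X_def a_def lookup_add lookup_sum R_at RS_at mods x
            del: sum_of_bool_mult_eq sum_mult_of_bool_eq)
      moreover have "Y a k = y k" for k
        using sum_residues_delta[OF n_pos, of "\<lambda>i. t i * y i" "\<lambda>i. int n dvd i - k" k] nz
        by (simp add: Y_def a_def lookup_add lookup_sum S_at RS_at mods y
            del: sum_of_bool_mult_eq sum_mult_of_bool_eq)
      moreover have "a \<in> carrier ?A"
      proof -
        have "Poly_Mapping.lookup a g = 0" if g: "g \<notin> carrier G" for g
        proof -
          have "R i \<noteq> g" "S i \<noteq> g" for i using g R_closed S_closed by blast+
          then show ?thesis by (simp add: a_def lookup_add lookup_sum lookup_single)
        qed
        then show ?thesis by (auto simp: twisted_group_ring_simps in_keys_iff)
      qed
      ultimately show ?thesis by (intro bexI[of _ a]) auto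
    qed
    fix a b k assume a: "a \<in> carrier ?A" and b: "b \<in> carrier ?A"
    note lookup = lookup_twisted_mult[OF a b] sum_carrier inv_R inv_S RR RS SR SS lookup_R lookup_S
    have "c k * X (a \<otimes>\<^bsub>?A\<^esub> b) k = (\<Sum>i\<in>{0..<int n}. c i * X a i * (c (k - i) * X b (k - i)) * \<alpha> (R i) (R (k - i))) +
        (\<Sum>i\<in>{0..<int n}. t i * Y a i * (t (i - k) * Y b (i - k)) * \<alpha> (S i) (S (i - k)))"
      using lookup(1)[OF R_closed, of k] by (simp only: lookup) (simp add: add.commute)
    also have "\<dots> = (\<Sum>i\<in>{0..<int n}. (c i * c (k - i) * \<alpha> (R i) (R (k - i))) * (X a i * X b (k - i))) +
        (\<Sum>i\<in>{0..<int n}. (t i * t (i - k) * \<alpha> (S i) (S (i - k))) * (Y a i * Y b (i - k)))"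
      by (simp only: mult_ac)
    also have "\<dots> = c k * (\<Sum>i\<in>{0..<int n}. X a i * X b (k - i) + \<mu> * (Y a i * Y b (i - k)))"
      unfolding cc tt by (simp add: sum.distrib sum_distrib_left distrib_left mult_ac)
    finally show "X (a \<otimes>\<^bsub>?A\<^esub> b) k = (\<Sum>i\<in>{0..<int n}. X a i * X b (k - i) + \<mu> * (Y a i * Y b (i - k)))"
      using nz by simp
    have "t k * Y (a \<otimes>\<^bsub>?A\<^esub> b) k = (\<Sum>i\<in>{0..<int n}. c i * X a i * (t (k - i) * Y b (k - i)) * \<alpha> (R i) (S (k - i))) +
        (\<Sum>i\<in>{0..<int n}. t i * Y a i * (c (i - k) * X b (i - k)) * \<alpha> (S i) (R (i - k)))"
      using lookup(1)[OF S_closed, of k] by (simp only: lookup) (simp add: add.commute)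
    also have "\<dots> = (\<Sum>i\<in>{0..<int n}. (c i * t (k - i) * \<alpha> (R i) (S (k - i))) * (X a i * Y b (k - i))) +
        (\<Sum>i\<in>{0..<int n}. (t i * c (i - k) * \<alpha> (S i) (R (i - k))) * (Y a i * X b (i - k)))"
      by (simp only: mult_ac)
    also have "\<dots> = t k * (\<Sum>i\<in>{0..<int n}. X a i * Y b (k - i) + Y a i * X b (i - k))"
      unfolding ct tc by (simp add: sum.distrib sum_distrib_left distrib_left mult_ac)
    finally show "Y (a \<otimes>\<^bsub>?A\<^esub> b) k = (\<Sum>i\<in>{0..<int n}. X a i * Y b (k - i) + Y a i * X b (i - k))"
      using nz by simp
  qed (use n char \<mu> in auto)
  then show ?thesis by (rule that)
qed

end

section \<open>The first Hochschild cohomology\<close>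

text \<open>
  Translation by 1 permutes the field, so it does not change the sum of all elements.
\<close>

lemma of_nat_card_UNIV: "of_nat (card (UNIV :: 'f::{field, finite} set)) = (0::'f)"
proof -
  have "(\<Sum>x\<in>UNIV. x + 1) = (\<Sum>x\<in>UNIV. x :: 'f)"
    by (rule sum.reindex_bij_witness[of _ "\<lambda>x. x - 1" "\<lambda>x. x + 1"]) auto
  then show ?thesis by (simp add: sum.distrib)
qed

theorem mainTheorem3:
  fixes G :: "('g, 'm) monoid_scheme"
    and \<alpha> :: "'g \<Rightarrow> 'g \<Rightarrow> 'f::{field, finite}"
    and n p k :: nat
  assumes "n > 2" and "odd n"
    and "dihedral_group n G"
    and "prime p" and "card (UNIV :: 'f set) = p ^ k" and "p dvd n"
    and "normalized_cocycle G \<alpha>"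
  shows "isomorphic_vector_spaces (class_ring :: 'f ring)
           (HH1 class_ring (twisted_group_ring G \<alpha>))
           (module_vec TYPE('f) ((n - 1) div 2))"
proof -
  have "of_nat p ^ k = (0::'f)"
    using of_nat_card_UNIV[where 'f = 'f] by (simp add: assms(5))
  then have "of_nat p = (0::'f)" by simp
  then have char: "of_nat n = (0::'f)" using assms(6) by (auto elim!: dvdE)
  obtain R S where "dihedral G n R S"
    using dihedral_group_dihedral[OF assms(3)] assms(1) by auto
  then interpret dihedral G n R S .
  obtain \<mu> X Y where "dihedral_algebra (twisted_group_ring G \<alpha>) n \<mu> X Y"
    by (rule twisted_group_ring_dihedral_algebra[OF assms(2) char assms(7)])
  then interpret dihedral_algebra "twisted_group_ring G \<alpha>" n \<mu> X Y .
  show ?thesis by (rule HH1_dihedral_algebra)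
qed

end
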